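(* Let $j\geq 2$ be an integer and let $T$ be a tree of order $n>10j$. Then $m_T(\mu_2)=\lfloor\frac{n}{2}\rfloor-j$ if and only if $T\cong T\!\left(\lceil\frac{n}{2}\rceil+j-2,\ \lfloor\frac{n}{2}\rfloor-j+1\right)$, where $\mu_2=\mu_2(T)$ is the algebraic connectivity of $T$.
   Context: For a graph $G$ on $n$ vertices, the Laplacian matrix is $L(G)=D(G)-A(G)$, with $D(G)$ the diagonal degree matrix and $A(G)$ the adjacency matrix. Its eigenvalues are denoted $0=\mu_1(G)\leq\mu_2(G)\leq\cdots\leq\mu_n(G)$; $\mu_2(G)$ is the algebraic connectivity, and $m_G(\mu)$ denotes the multiplicity of $\mu$ as an eigenvalue of $L(G)$. For integers $1\leq k\leq s$, the spider $T(s,k)$ is the tree obtained from the star $K_{1,s}$ by extending $k$ of its $s$ rays by one extra edge each; it has $s+k+1$ vertices. *)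

theory Defs
  imports "Jordan_Normal_Form.Char_Poly" "HOL-Library.Multiset"
begin

definition sgraph :: "nat \<Rightarrow> (nat \<Rightarrow> nat \<Rightarrow> bool) \<Rightarrow> bool" where
  "sgraph n E \<longleftrightarrow> (\<forall>i j. E i j \<longrightarrow> i < n \<and> j < n \<and> i \<noteq> j \<and> E j i)"

definition connected_graph :: "nat \<Rightarrow> (nat \<Rightarrow> nat \<Rightarrow> bool) \<Rightarrow> bool" where
  "connected_graph n E \<longleftrightarrow> (\<forall>i<n. \<forall>j<n. E\<^sup>*\<^sup>* i j)"

definition has_cycle :: "(nat \<Rightarrow> nat \<Rightarrow> bool) \<Rightarrow> bool" where
  "has_cycle E \<longleftrightarrow> (\<exists>vs. length vs \<ge> 3 \<and> distinct vs \<and>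
      (\<forall>i. Suc i < length vs \<longrightarrow> E (vs ! i) (vs ! Suc i)) \<and> E (last vs) (hd vs))"

definition is_tree :: "nat \<Rightarrow> (nat \<Rightarrow> nat \<Rightarrow> bool) \<Rightarrow> bool" where
  "is_tree n E \<longleftrightarrow> sgraph n E \<and> n \<ge> 1 \<and> connected_graph n E \<and> \<not> has_cycle E"

definition graph_iso :: "nat \<Rightarrow> (nat \<Rightarrow> nat \<Rightarrow> bool) \<Rightarrow> (nat \<Rightarrow> nat \<Rightarrow> bool) \<Rightarrow> bool" where
  "graph_iso n E E' \<longleftrightarrow> (\<exists>f. bij_betw f {..<n} {..<n} \<and>
      (\<forall>i<n. \<forall>j<n. E i j \<longleftrightarrow> E' (f i) (f j)))"

definition degree :: "nat \<Rightarrow> (nat \<Rightarrow> nat \<Rightarrow> bool) \<Rightarrow> nat \<Rightarrow> nat" where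
  "degree n E i = card {k. k < n \<and> E i k}"

definition laplacian :: "nat \<Rightarrow> (nat \<Rightarrow> nat \<Rightarrow> bool) \<Rightarrow> real mat" where
  "laplacian n E = mat n n (\<lambda>(i,j). (if i = j then real (degree n E i) else 0)
                                    - (if E i j then 1 else 0))"

definition lap_eigenvalues :: "nat \<Rightarrow> (nat \<Rightarrow> nat \<Rightarrow> bool) \<Rightarrow> real list" where
  "lap_eigenvalues n E = sorted_list_of_multiset (proots (char_poly (laplacian n E)))"

definition lap_mu :: "nat \<Rightarrow> (nat \<Rightarrow> nat \<Rightarrow> bool) \<Rightarrow> nat \<Rightarrow> real" where
  "lap_mu n E k = lap_eigenvalues n E ! (k - 1)"

definition lap_mult :: "nat \<Rightarrow> (nat \<Rightarrow> nat \<Rightarrow> bool) \<Rightarrow> real \<Rightarrow> nat" where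
  "lap_mult n E \<mu> = count (proots (char_poly (laplacian n E))) \<mu>"

text \<open>Spider T(s,k) on vertices {0..<s+k+1}: centre 0, rays 0-i (1<=i<=s),
  and the rays i=1..k extended by the edge i-(s+i).\<close>
definition spider_arc :: "nat \<Rightarrow> nat \<Rightarrow> nat \<Rightarrow> nat \<Rightarrow> bool" where
  "spider_arc s k i j \<longleftrightarrow> (i = 0 \<and> 1 \<le> j \<and> j \<le> s) \<or> (1 \<le> i \<and> i \<le> k \<and> j = s + i)"

definition spider :: "nat \<Rightarrow> nat \<Rightarrow> nat \<Rightarrow> nat \<Rightarrow> bool" where
  "spider s k i j \<longleftrightarrow> spider_arc s k i j \<or> spider_arc s k j i"

end

theory Submission
  imports Defs "HOL-Analysis.Function_Topology"
begin

text \<open>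
  Let \<open>\<mu>\<close> be the algebraic connectivity of a tree, that is, the minimum of the Rayleigh quotient on the
  vectors with zero sum. If \<open>\<mu>\<close> is multiple, some eigenvector \<open>z\<close> vanishes at a vertex \<open>v\<close> but not at all
  of its neighbours. Two vectors with nonzero sums and Rayleigh quotient at most \<open>\<mu>\<close>, carried by different
  branches at \<open>v\<close>, have a combination with zero sum and hence both attain \<open>\<mu>\<close>. Applied to the positive and
  negative parts of \<open>z\<close>, this shows that every eigenvector for \<open>\<mu>\<close> vanishes at \<open>v\<close> and is determined by its
  values at the neighbours of \<open>v\<close>, so the multiplicity is less than the number of branches on which some
  eigenvector is nonzero.

  When the multiplicity is about \<open>n/2\<close>, one of these branches has at most two vertices. One vertex gives
  \<open>\<mu> = 1\<close> and a star, whose multiplicity is too large; two vertices give \<open>\<mu> = (3 - \<surd>5)/2\<close>. A test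
  vector then shows that no branch has three or more vertices, since its Rayleigh quotient would be below
  \<open>\<mu>\<close>. So the tree is a spider, and the multiplicity for a spider with \<open>k \<ge> 2\<close> long legs is \<open>k - 1\<close>.
\<close>

section \<open>Spectral theorem for real symmetric matrices\<close>

text \<open>Vectors are functions on \<open>nat\<close> of which only the entries below
  \<open>n\<close> count.\<close>

definition ip :: "nat \<Rightarrow> (nat \<Rightarrow> real) \<Rightarrow> (nat \<Rightarrow> real) \<Rightarrow> real" where
  "ip n x y = (\<Sum>i<n. x i * y i)"

definition ap :: "nat \<Rightarrow> (nat \<Rightarrow> nat \<Rightarrow> real) \<Rightarrow> (nat \<Rightarrow> real) \<Rightarrow> nat \<Rightarrow> real" where
  "ap n M x i = (\<Sum>j<n. M i j * x j)"

lemma ip_commute: "ip n x y = ip n y x"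
  by (simp add: ip_def mult.commute)

lemma ip_add_left: "ip n (\<lambda>i. x i + y i) z = ip n x z + ip n y z"
  by (simp add: ip_def algebra_simps sum.distrib)

lemma ip_scale_left: "ip n (\<lambda>i. c * x i) z = c * ip n x z"
  by (simp add: ip_def algebra_simps sum_distrib_left)

lemma ip_add_right: "ip n z (\<lambda>i. x i + y i) = ip n z x + ip n z y"
  by (simp add: ip_def algebra_simps sum.distrib)

lemma ip_scale_right: "ip n z (\<lambda>i. c * x i) = c * ip n z x"
  by (simp add: ip_def algebra_simps sum_distrib_left)

lemma ip_sum_left: "ip n (\<lambda>i. \<Sum>a\<in>A. f a i) z = (\<Sum>a\<in>A. ip n (f a) z)"
  unfolding ip_def sum_distrib_right by (rule sum.swap)

lemma ip_cong: "(\<And>i. i < n \<Longrightarrow> x i = x' i) \<Longrightarrow> (\<And>i. i < n \<Longrightarrow> y i = y' i) \<Longrightarrow> ip n x y = ip n x' y'"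
  by (simp add: ip_def)

lemma ip_nonneg: "ip n x x \<ge> 0"
  by (simp add: ip_def sum_nonneg)

lemma ip_eq_0_iff: "ip n x x = 0 \<longleftrightarrow> (\<forall>i<n. x i = 0)"
  by (auto simp: ip_def sum_nonneg_eq_0_iff)

lemma ap_add: "ap n M (\<lambda>i. x i + y i) = (\<lambda>i. ap n M x i + ap n M y i)"
  by (auto simp: ap_def algebra_simps sum.distrib)

lemma ap_scale: "ap n M (\<lambda>i. c * x i) = (\<lambda>i. c * ap n M x i)"
  by (auto simp: ap_def algebra_simps sum_distrib_left)

lemma ap_cong: "(\<And>i. i < n \<Longrightarrow> x i = y i) \<Longrightarrow> ap n M x = ap n M y"
  by (auto simp: ap_def)

lemma ip_ap_sym:
  assumes "\<And>i j. i < n \<Longrightarrow> j < n \<Longrightarrow> M i j = M j i"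
  shows "ip n x (ap n M y) = ip n (ap n M x) y"
proof -
  have "ip n x (ap n M y) = (\<Sum>i<n. \<Sum>j<n. x i * M i j * y j)"
    by (simp add: ip_def ap_def sum_distrib_left algebra_simps)
  also have "\<dots> = (\<Sum>j<n. \<Sum>i<n. x i * M i j * y j)" by (rule sum.swap)
  also have "\<dots> = ip n (ap n M x) y"
    by (simp add: ip_def ap_def sum_distrib_left sum_distrib_right algebra_simps assms)
  finally show ?thesis .
qed

text \<open>Requiring the entries from \<open>n\<close> on to vanish makes \<open>C\<close> a closed
  subset of a product of intervals [-1, 1], compact by Tychonoff, and the quadratic form is
  continuous on it.\<close>

lemma rayleigh_minimum_attained:
  fixes u :: "nat \<Rightarrow> nat \<Rightarrow> real" and k n :: nat
  defines "C \<equiv> {x. (\<forall>i\<ge>n. x i = 0) \<and> ip n x x = 1 \<and> (\<forall>i<k. ip n x (u i) = 0)}"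
  assumes "C \<noteq> {}"
  shows "\<exists>x\<in>C. \<forall>y\<in>C. ip n x (ap n M x) \<le> ip n y (ap n M y)"
proof (rule continuous_attains_inf)
  have "compactin (product_topology (\<lambda>i::nat. euclideanreal) UNIV) (PiE UNIV (\<lambda>_. {-1..1}))"
    by (simp add: compactin_PiE)
  then have box: "compact (PiE (UNIV :: nat set) (\<lambda>_. {-1..1::real}))"
    by (simp add: euclidean_product_topology flip: compactin_euclidean_iff)
  have coord: "continuous_on UNIV (\<lambda>x :: nat \<Rightarrow> real. x i)" for i
    by (rule continuous_on_product_coordinates)
  have "closed C"
    unfolding C_def ip_def
    by (intro closed_Collect_conj closed_Collect_all closed_Collect_imp open_Collect_const
        closed_Collect_eq continuous_intros coord)
  moreover have "C \<subseteq> PiE UNIV (\<lambda>_. {-1..1})"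
  proof
    fix x assume x: "x \<in> C"
    have "x i \<in> {-1..1}" for i
    proof (cases "i < n")
      case True
      have "x i * x i \<le> ip n x x"
        unfolding ip_def by (rule member_le_sum) (use True in auto)
      then have "(x i)\<^sup>2 \<le> 1" using x by (simp add: C_def power2_eq_square)
      then show ?thesis by (auto simp: abs_square_le_1 abs_le_iff)
    qed (use x in \<open>auto simp: C_def\<close>)
    then show "x \<in> PiE UNIV (\<lambda>_. {-1..1})" by (auto simp: PiE_iff)
  qed
  ultimately show "compact C"
    using box by (metis closed_Int_compact inf.absorb_iff1)
  show "C \<noteq> {}" by fact
  show "continuous_on C (\<lambda>x. ip n x (ap n M x))"
    unfolding ip_def ap_def
    by (rule continuous_on_subset[of UNIV]) (auto intro!: continuous_intros coord)
qed

text \<open>The first-order condition at a minimum: for small \<open>t\<close> of sign opposite to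
  \<open>a\<close> the linear term outweighs the quadratic one.\<close>

lemma quadratic_nonneg_imp_linear_zero:
  fixes a b :: real
  assumes "\<And>t. 2 * t * a + t\<^sup>2 * b \<ge> 0"
  shows "a = 0"
proof (rule ccontr)
  assume a: "a \<noteq> 0"
  define s where "s = 1 / (\<bar>b\<bar> + 1)"
  have s: "s > 0" "s * b < 1" "s * (\<bar>b\<bar> + 1) = 1"
    by (auto simp: s_def field_simps)
  have "2 * (- a * s) * a + (- a * s)\<^sup>2 * b = a\<^sup>2 * s * (s * b - 2)"
    by (simp add: power2_eq_square algebra_simps)
  moreover have "a\<^sup>2 * s * (s * b - 2) < 0"
    using a s by (intro mult_pos_neg) auto
  ultimately show False using assms[of "- a * s"] by linarith
qed

text \<open>\<open>r a\<close> is the \<open>a\<close>-th unit vector minus its projection to the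
  span of the \<open>u i\<close>. The squared norms of all \<open>r a\<close> sum to
  \<open>n - k > 0\<close>, so one of them is nonzero and can be normalised.\<close>

lemma orthonormal_extend:
  fixes u :: "nat \<Rightarrow> nat \<Rightarrow> real"
  assumes "k < n" and on: "\<And>i j. i < k \<Longrightarrow> j < k \<Longrightarrow> ip n (u i) (u j) = (if i = j then 1 else 0)"
  shows "\<exists>x. (\<forall>i\<ge>n. x i = 0) \<and> ip n x x = 1 \<and> (\<forall>i<k. ip n x (u i) = 0)"
proof -
  define r where "r a = (\<lambda>b. (if b = a then 1 else 0) + (\<Sum>i<k. (- u i a) * u i b))" for a
  have e: "ip n (\<lambda>b. if b = a then 1 else 0) y = y a" if "a < n" for a y
    using that by (simp add: ip_def if_distrib[of "\<lambda>c. c * _"] cong: if_cong)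
  have ru: "ip n (r a) (u j) = 0" if "a < n" "j < k" for a j
    unfolding r_def ip_add_left ip_sum_left ip_scale_left e[OF that(1)]
    using that by (simp add: on if_distrib cong: if_cong)
  have rr: "ip n (r a) (r a) = 1 - (\<Sum>i<k. (u i a)\<^sup>2)" if "a < n" for a
  proof -
    have "ip n (r a) (r a) = r a a + (\<Sum>i<k. (- u i a) * ip n (u i) (r a))"
      by (subst (1) r_def) (simp only: ip_add_left ip_sum_left ip_scale_left e[OF that])
    also have "\<dots> = r a a" using ru[OF that] by (simp add: ip_commute)
    finally show ?thesis by (simp add: r_def power2_eq_square sum_negf)
  qed
  have "(\<Sum>a<n. \<Sum>i<k. (u i a)\<^sup>2) = (\<Sum>i<k. ip n (u i) (u i))"
    unfolding ip_def power2_eq_square by (rule sum.swap)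
  also have "\<dots> = k" by (simp add: on)
  finally have "(\<Sum>a<n. ip n (r a) (r a)) = real n - k"
    by (simp add: rr sum_subtractf)
  then have "\<exists>a<n. ip n (r a) (r a) \<noteq> 0"
    using \<open>k < n\<close> by (metis (no_types, lifting) lessThan_iff of_nat_less_iff order_less_irrefl
        right_minus_eq sum.neutral)
  then obtain a where a: "a < n" "ip n (r a) (r a) \<noteq> 0" by auto
  define c where "c = 1 / sqrt (ip n (r a) (r a))"
  define x where "x i = (if i < n then c * r a i else 0)" for i
  have cc: "c * c * ip n (r a) (r a) = 1"
    using a(2) ip_nonneg[of n "r a"] by (simp add: c_def)
  have ipx: "ip n x y = c * ip n (r a) y" for y
    unfolding ip_scale_left[symmetric] by (rule ip_cong) (auto simp: x_def)
  have "ip n x x = 1"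
    using cc by (simp add: ipx ip_commute[of n "r a" x])
  then show ?thesis
    using ru[OF a(1)] by (intro exI[of _ x]) (auto simp: ipx, auto simp: x_def)
qed

text \<open>Eigenvectors are found one at a time: the next one minimises the quadratic form on the
  unit vectors orthogonal to the earlier ones.\<close>

theorem symmetric_orthonormal_eigenbasis:
  assumes sym: "\<And>i j. i < n \<Longrightarrow> j < n \<Longrightarrow> M i j = M j i"
  shows "\<exists>u d. (\<forall>i<n. \<forall>j<n. ip n (u i) (u j) = (if i = j then 1 else 0)) \<and>
               (\<forall>i<n. \<forall>a<n. ap n M (u i) a = d i * u i a)"
proof -
  have "\<exists>u d. (\<forall>i<k. \<forall>j<k. ip n (u i) (u j) = (if i = j then 1 else 0)) \<and>
               (\<forall>i<k. \<forall>a<n. ap n M (u i) a = d i * u i a)" if "k \<le> n" for k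
    using that
  proof (induction k)
    case 0
    show ?case by auto
  next
    case (Suc k)
    then have "k \<le> n" by simp
    from Suc.IH[OF this] obtain u d
      where "(\<forall>i<k. \<forall>j<k. ip n (u i) (u j) = (if i = j then 1 else 0)) \<and>
             (\<forall>i<k. \<forall>a<n. ap n M (u i) a = d i * u i a)" by (elim exE)
    then have on: "\<And>i j. i < k \<Longrightarrow> j < k \<Longrightarrow> ip n (u i) (u j) = (if i = j then 1 else 0)"
      and ev: "\<And>i a. i < k \<Longrightarrow> a < n \<Longrightarrow> ap n M (u i) a = d i * u i a" by blast+
    define C where "C = {x. (\<forall>i\<ge>n. x i = 0) \<and> ip n x x = 1 \<and> (\<forall>i<k. ip n x (u i) = 0)}"
    have "C \<noteq> {}" using orthonormal_extend[of k n u] on Suc.prems by (auto simp: C_def)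
    then obtain x where xC: "x \<in> C" and min: "\<And>y. y \<in> C \<Longrightarrow> ip n x (ap n M x) \<le> ip n y (ap n M y)"
      using rayleigh_minimum_attained[of n k u M] unfolding C_def by blast
    define l where "l = ip n x (ap n M x)"
    \<comment> \<open>By homogeneity the bound passes from unit vectors to all vectors orthogonal to
      the \<open>u i\<close>; \<open>z\<close> is \<open>y\<close> normalised and cut off at
      \<open>n\<close>, to lie in \<open>C\<close>.\<close>
    have low: "l * ip n y y \<le> ip n y (ap n M y)" if "\<forall>i<k. ip n y (u i) = 0" for y
    proof (cases "ip n y y = 0")
      case True
      then have "\<forall>i<n. y i = 0" by (simp only: ip_eq_0_iff)
      then have "ip n y (ap n M y) = 0" by (simp add: ip_def)
      then show ?thesis using True by simp
    next
      case False
      then have pos: "ip n y y > 0" using ip_nonneg[of n y] by linarith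
      define c where "c = 1 / sqrt (ip n y y)"
      have c2: "c * (c * w) = w / ip n y y" for w
        using pos by (simp add: c_def flip: mult.assoc)
      define z where "z i = (if i < n then c * y i else 0)" for i
      have ipz: "ip n z w = c * ip n y w" for w
        unfolding ip_scale_left[symmetric] by (rule ip_cong) (auto simp: z_def)
      have apz: "ap n M z = (\<lambda>i. c * ap n M y i)"
        unfolding ap_scale[symmetric] by (rule ap_cong) (auto simp: z_def)
      have "z \<in> C"
        using that c2 pos by (auto simp: C_def ipz ip_commute[of n y z]) (auto simp: z_def)
      then have "l \<le> ip n z (ap n M z)" unfolding l_def by (rule min)
      also have "\<dots> = ip n y (ap n M y) / ip n y y"
        by (simp add: ipz apz ip_scale_right c2)
      finally show ?thesis using pos by (simp add: field_simps)
    qed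
    \<comment> \<open>The residual \<open>g\<close> is again orthogonal to the \<open>u i\<close>,
      so \<open>low\<close> applies to \<open>x + t g\<close> for every \<open>t\<close>. The linear
      coefficient of the resulting inequality is twice \<open>ip n g g\<close>, which must
      vanish.\<close>
    define g where "g a = ap n M x a + (- l) * x a" for a
    have xu: "ip n x (u i) = 0" if "i < k" for i using xC that by (simp add: C_def)
    have xx: "ip n x x = 1" using xC by (simp add: C_def)
    have gu: "ip n g (u i) = 0" if "i < k" for i
    proof -
      have "ip n (ap n M x) (u i) = ip n x (ap n M (u i))"
        by (rule ip_ap_sym[OF sym, symmetric]) auto
      also have "\<dots> = ip n x (\<lambda>a. d i * u i a)" by (rule ip_cong) (auto simp: ev that)
      also have "\<dots> = 0" by (simp add: ip_scale_right xu that)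
      finally show ?thesis unfolding g_def ip_add_left ip_scale_left by (simp add: xu that)
    qed
    have "ip n g g = ip n g (ap n M x) + (- l) * ip n x g"
      unfolding ip_commute[of n x g] ip_scale_right[symmetric] ip_add_right[symmetric]
      by (rule ip_cong) (auto simp: g_def)
    then have gx: "ip n g (ap n M x) = ip n g g + l * ip n x g" by simp
    have "ip n g g = 0"
    proof (rule quadratic_nonneg_imp_linear_zero)
      fix t :: real
      define y where "y a = x a + t * g a" for a
      have "l * ip n y y \<le> ip n y (ap n M y)"
        by (rule low) (simp add: y_def[abs_def] ip_add_left ip_scale_left xu gu)
      moreover have "ip n y y = 1 + 2 * t * ip n x g + t\<^sup>2 * ip n g g"
        by (simp add: y_def[abs_def] ip_add_left ip_scale_left ip_add_right ip_scale_right xx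
            ip_commute[of n g x] power2_eq_square algebra_simps)
      moreover have "ip n y (ap n M y) = l + 2 * t * ip n g (ap n M x) + t\<^sup>2 * ip n g (ap n M g)"
        using ip_ap_sym[of n M x g, OF sym] ip_commute[of n g "ap n M x"]
        by (simp add: y_def[abs_def] ip_add_left ip_scale_left ap_add ap_scale ip_add_right
            ip_scale_right power2_eq_square algebra_simps l_def)
      ultimately show "0 \<le> 2 * t * ip n g g + t\<^sup>2 * (ip n g (ap n M g) - l * ip n g g)"
        unfolding gx by (simp add: algebra_simps)
    qed
    then have evx: "ap n M x a = l * x a" if "a < n" for a
      using that by (auto simp: ip_eq_0_iff g_def)
    show ?case
      by (rule exI[of _ "u(k := x)"], rule exI[of _ "d(k := l)"])
        (auto simp: less_Suc_eq on ev evx xx xu ip_commute[of n "u _" x])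
  qed
  then show ?thesis by blast
qed

text \<open>Gaussian elimination. It stands in for dimension theory in both bounds on
  multiplicities.\<close>

lemma underdetermined_system_nontrivial_solution:
  fixes A :: "'s \<Rightarrow> 'i \<Rightarrow> real"
  assumes "finite S" "finite I" "card S < card I"
  shows "\<exists>c. (\<exists>i\<in>I. c i \<noteq> 0) \<and> (\<forall>s\<in>S. (\<Sum>i\<in>I. A s i * c i) = 0)"
  using assms
proof (induction S arbitrary: I A rule: finite_induct)
  case empty
  then have "I \<noteq> {}" by auto
  then show ?case by (intro exI[of _ "\<lambda>_. 1"]) auto
next
  case (insert s S)
  show ?case
  proof (cases "\<forall>i\<in>I. A s i = 0")
    case True
    have "card S < card I" using insert by simp
    with insert.IH[OF insert.prems(1), of A] obtain c
      where "\<exists>i\<in>I. c i \<noteq> 0" "\<forall>s\<in>S. (\<Sum>i\<in>I. A s i * c i) = 0" by auto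
    then show ?thesis using True by (intro exI[of _ c]) auto
  next
    case False
    then obtain p where p: "p \<in> I" "A s p \<noteq> 0" by auto
    \<comment> \<open>Subtracting a multiple of equation \<open>s\<close> removes the unknown
      \<open>p\<close> from equation \<open>t\<close>; afterwards \<open>c' p\<close> is read off
      from equation \<open>s\<close>.\<close>
    define A' where "A' t i = A t i - A t p * A s i / A s p" for t i
    have "card S < card (I - {p})" using insert p by simp
    with insert.IH[of "I - {p}" A'] insert.prems obtain c
      where c: "\<exists>i\<in>I - {p}. c i \<noteq> 0" "\<forall>t\<in>S. (\<Sum>i\<in>I - {p}. A' t i * c i) = 0" by auto
    define c' where "c' = c(p := - (\<Sum>i\<in>I - {p}. A s i * c i) / A s p)"
    have eq: "(\<Sum>i\<in>I. A t i * c' i) = (\<Sum>i\<in>I - {p}. A' t i * c i)" for t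
    proof -
      have "(\<Sum>i\<in>I. A t i * c' i) = A t p * c' p + (\<Sum>i\<in>I - {p}. A t i * c i)"
        using p insert.prems by (subst sum.remove[of _ p]) (auto simp: c'_def intro!: sum.cong)
      also have "\<dots> = (\<Sum>i\<in>I - {p}. A' t i * c i)"
        by (simp add: c'_def A'_def left_diff_distrib sum_subtractf sum_distrib_left
            sum_divide_distrib sum_negf algebra_simps)
      finally show ?thesis .
    qed
    have "(\<Sum>i\<in>I - {p}. A' s i * c i) = 0" using p by (simp add: A'_def)
    moreover from c(1) have "\<exists>i\<in>I. c' i \<noteq> 0" by (auto simp: c'_def)
    ultimately show ?thesis
      using c(2) by (intro exI[of _ c']) (simp add: eq)
  qed
qed

text \<open>With the \<open>u i\<close> as columns of \<open>U\<close>, orthonormality says that the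
  transpose \<open>V\<close> is a left inverse. It is then also a right inverse, which gives
  similarity to a diagonal matrix and, entry by entry, the expansion of \<open>x\<close>.\<close>

lemma orthonormal_eigenbasis_complete:
  assumes on: "\<forall>i<n. \<forall>j<n. ip n (u i) (u j) = (if i = j then 1 else 0)"
    and ev: "\<forall>i<n. \<forall>a<n. ap n M (u i) a = d i * u i a"
  shows "char_poly (mat n n (\<lambda>(i,j). M i j)) = (\<Prod>i<n. [:- d i, 1:])"
    and "\<And>x a. a < n \<Longrightarrow> x a = (\<Sum>i<n. ip n x (u i) * u i a)"
proof -
  define U where "U = mat n n (\<lambda>(a,i). u i a)"
  define V where "V = mat n n (\<lambda>(i,a). u i a)"
  define D where "D = mat n n (\<lambda>(i,j). if i = j then d i else 0)"
  define A where "A = mat n n (\<lambda>(i,j). M i j)"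
  have carr: "U \<in> carrier_mat n n" "V \<in> carrier_mat n n" "D \<in> carrier_mat n n" "A \<in> carrier_mat n n"
    by (auto simp: U_def V_def D_def A_def)
  have "V * U = 1\<^sub>m n"
    using on by (intro eq_matI) (auto simp: U_def V_def scalar_prod_def ip_def lessThan_atLeast0)
  then have UV: "U * V = 1\<^sub>m n" using mat_mult_left_right_inverse carr by blast
  have AU: "A * U = U * D"
  proof (rule eq_matI)
    fix a i assume "a < dim_row (U * D)" "i < dim_col (U * D)"
    then have ai: "a < n" "i < n" by (auto simp: U_def D_def)
    have "(A * U) $$ (a, i) = ap n M (u i) a"
      using ai by (simp add: A_def U_def scalar_prod_def ap_def lessThan_atLeast0)
    also have "\<dots> = (U * D) $$ (a, i)"
      using ai ev by (simp add: D_def U_def scalar_prod_def if_distrib[of "\<lambda>c. _ * c"] cong: if_cong)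
    finally show "(A * U) $$ (a, i) = (U * D) $$ (a, i)" .
  qed (auto simp: A_def U_def D_def)
  have "A = A * (U * V)" using carr by (simp add: UV)
  also have "\<dots> = (A * U) * V" using carr by (simp add: assoc_mult_mat)
  also have "\<dots> = U * D * V" by (simp add: AU)
  finally have "similar_mat_wit A D U V"
    using carr UV \<open>V * U = 1\<^sub>m n\<close> by (simp add: similar_mat_wit_def Let_def)
  then have "char_poly A = char_poly D" by (intro char_poly_similar) (auto simp: similar_mat_def)
  also have "\<dots> = (\<Prod>a\<leftarrow>diag_mat D. [:- a, 1:])"
    by (rule char_poly_upper_triangular[OF carr(3)]) (auto simp: D_def)
  also have "\<dots> = (\<Prod>i<n. [:- d i, 1:])"
    by (simp add: diag_mat_def D_def prod.list_conv_set_nth lessThan_atLeast0)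
  finally show "char_poly (mat n n (\<lambda>(i,j). M i j)) = (\<Prod>i<n. [:- d i, 1:])" by (simp add: A_def)
  fix x :: "nat \<Rightarrow> real" and a assume a: "a < n"
  have UVab: "(\<Sum>i<n. u i a * u i b) = (if a = b then 1 else 0)" if "b < n" for b
  proof -
    have "(\<Sum>i<n. u i a * u i b) = (U * V) $$ (a, b)"
      using a that by (simp add: U_def V_def scalar_prod_def lessThan_atLeast0)
    then show ?thesis using a that by (simp add: UV)
  qed
  have "(\<Sum>i<n. ip n x (u i) * u i a) = (\<Sum>i<n. \<Sum>b<n. x b * (u i a * u i b))"
    unfolding ip_def sum_distrib_right by (intro sum.cong refl) (simp add: mult_ac)
  also have "\<dots> = (\<Sum>b<n. \<Sum>i<n. x b * (u i a * u i b))" by (rule sum.swap)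
  also have "\<dots> = (\<Sum>b<n. x b * (if a = b then 1 else 0))"
    by (simp add: UVab flip: sum_distrib_left)
  also have "\<dots> = x a" using a by (simp add: if_distrib cong: if_cong)
  finally show "x a = (\<Sum>i<n. ip n x (u i) * u i a)" by simp
qed

section \<open>Laplacian eigenvectors of a graph\<close>

text \<open>The Laplacian matrix applied to \<open>x\<close>, in the form of edge differences that
  suits sign arguments at a single vertex.\<close>

definition lap_apply :: "nat \<Rightarrow> (nat \<Rightarrow> nat \<Rightarrow> bool) \<Rightarrow> (nat \<Rightarrow> real) \<Rightarrow> nat \<Rightarrow> real" where
  "lap_apply n E x i = (\<Sum>j | j < n \<and> E i j. x i - x j)"

definition lap_eigenvector :: "nat \<Rightarrow> (nat \<Rightarrow> nat \<Rightarrow> bool) \<Rightarrow> real \<Rightarrow> (nat \<Rightarrow> real) \<Rightarrow> bool" where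
  "lap_eigenvector n E l x \<longleftrightarrow> (\<forall>i<n. lap_apply n E x i = l * x i)"

abbreviation lap_entry :: "nat \<Rightarrow> (nat \<Rightarrow> nat \<Rightarrow> bool) \<Rightarrow> nat \<Rightarrow> nat \<Rightarrow> real" where
  "lap_entry n E i j \<equiv> (if i = j then real (Defs.degree n E i) else 0) - (if E i j then 1 else 0)"

lemma ap_lap_entry: "i < n \<Longrightarrow> ap n (lap_entry n E) x i = lap_apply n E x i"
proof -
  assume i: "i < n"
  have "ap n (lap_entry n E) x i
      = (\<Sum>j<n. (if i = j then real (Defs.degree n E i) * x j else 0)) - (\<Sum>j<n. if E i j then x j else 0)"
    unfolding ap_def sum_subtractf[symmetric] by (intro sum.cong) (auto simp: algebra_simps)
  also have "(\<Sum>j<n. if E i j then x j else 0) = (\<Sum>j | j < n \<and> E i j. x j)"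
    by (simp add: sum.inter_filter[symmetric])
  finally show ?thesis
    using i by (simp add: lap_apply_def sum_subtractf Defs.degree_def)
qed

locale simple_graph =
  fixes n :: nat and E :: "nat \<Rightarrow> nat \<Rightarrow> bool"
  assumes sgraph: "sgraph n E"
begin

lemma adj_sym: "E i j \<Longrightarrow> E j i"
  and adj_less: "E i j \<Longrightarrow> i < n" "E i j \<Longrightarrow> j < n"
  and adj_neq: "E i j \<Longrightarrow> i \<noteq> j"
  using sgraph by (auto simp: sgraph_def)

lemma ip_lap_sym: "ip n x (lap_apply n E y) = ip n (lap_apply n E x) y"
proof -
  have "ip n x (ap n (lap_entry n E) y) = ip n (ap n (lap_entry n E) x) y"
    by (rule ip_ap_sym) (use adj_sym in auto)
  moreover have "ip n x (ap n (lap_entry n E) y) = ip n x (lap_apply n E y)"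
    "ip n (ap n (lap_entry n E) x) y = ip n (lap_apply n E x) y"
    by (rule ip_cong; simp add: ap_lap_entry)+
  ultimately show ?thesis by simp
qed

text \<open>Every edge occurs in both orders in the double sum, whence the factor 2.\<close>

lemma ip_lap_self:
  "2 * ip n x (lap_apply n E x) = (\<Sum>i<n. \<Sum>j | j < n \<and> E i j. (x i - x j)\<^sup>2)"
proof -
  let ?f = "\<lambda>i j. if E i j then x i * (x i - x j) else 0"
  have A: "ip n x (lap_apply n E x) = (\<Sum>i<n. \<Sum>j<n. ?f i j)"
    by (simp add: ip_def lap_apply_def sum_distrib_left sum.inter_filter[symmetric])
  also have "\<dots> = (\<Sum>i<n. \<Sum>j<n. ?f j i)" by (rule sum.swap)
  finally have "2 * ip n x (lap_apply n E x) = (\<Sum>i<n. \<Sum>j<n. ?f i j + ?f j i)"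
    using A by (simp add: sum.distrib)
  also have "\<dots> = (\<Sum>i<n. \<Sum>j<n. if E i j then (x i - x j)\<^sup>2 else 0)"
    by (intro sum.cong refl) (auto simp: power2_eq_square algebra_simps dest: adj_sym)
  finally show ?thesis by (simp add: sum.inter_filter[symmetric])
qed

lemma sum_lap_apply: "(\<Sum>i<n. lap_apply n E x i) = 0"
proof -
  have "(\<Sum>i<n. lap_apply n E x i) = ip n (lap_apply n E x) (\<lambda>_. 1)" by (simp add: ip_def)
  also have "\<dots> = ip n x (lap_apply n E (\<lambda>_. 1))" by (simp add: ip_lap_sym)
  also have "\<dots> = 0" by (simp add: ip_def lap_apply_def)
  finally show ?thesis .
qed

lemma lap_eigenvector_sum: "lap_eigenvector n E l x \<Longrightarrow> l \<noteq> 0 \<Longrightarrow> (\<Sum>i<n. x i) = 0"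
  using sum_lap_apply[of x] by (simp add: lap_eigenvector_def flip: sum_distrib_left)

text \<open>The factored characteristic polynomial turns the multiplicity of a root into the number
  of indices \<open>i\<close> whose \<open>d i\<close> equals it.\<close>

lemma lap_orthonormal_eigenbasis:
  obtains u :: "nat \<Rightarrow> nat \<Rightarrow> real" and d :: "nat \<Rightarrow> real"
  where "\<And>i j. i < n \<Longrightarrow> j < n \<Longrightarrow> ip n (u i) (u j) = (if i = j then 1 else 0)"
    and "\<And>i. i < n \<Longrightarrow> lap_eigenvector n E (d i) (u i)"
    and "\<And>x a. a < n \<Longrightarrow> x a = (\<Sum>i<n. ip n x (u i) * u i a)"
    and "proots (char_poly (laplacian n E)) = image_mset d (mset_set {..<n})"
proof -
  have "\<exists>u d. (\<forall>i<n. \<forall>j<n. ip n (u i) (u j) = (if i = j then 1 else 0)) \<and>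
      (\<forall>i<n. \<forall>a<n. ap n (lap_entry n E) (u i) a = d i * u i a)"
    by (rule symmetric_orthonormal_eigenbasis) (use adj_sym in auto)
  then obtain u d where on: "\<forall>i<n. \<forall>j<n. ip n (u i) (u j) = (if i = j then 1 else 0)"
    and ev: "\<forall>i<n. \<forall>a<n. ap n (lap_entry n E) (u i) a = d i * u i a" by blast
  note * = orthonormal_eigenbasis_complete[OF on ev]
  have "proots (char_poly (laplacian n E)) = (\<Sum>i<n. {#d i#})"
    unfolding laplacian_def *(1) by (subst proots_prod) auto
  also have "\<dots> = image_mset d (mset_set {..<n})"
    by (induction n) (auto simp: lessThan_Suc)
  finally show thesis
    using that[of u d] on ev *(2) by (auto simp: lap_eigenvector_def ap_lap_entry)
qed

lemma lap_eigenvector_orthogonal: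
  assumes "lap_eigenvector n E l x" "lap_eigenvector n E l' y" "l \<noteq> l'"
  shows "ip n x y = 0"
proof -
  have "l' * ip n x y = ip n x (lap_apply n E y)"
    unfolding ip_scale_right[symmetric] using assms by (intro ip_cong) (auto simp: lap_eigenvector_def)
  also have "\<dots> = ip n (lap_apply n E x) y" by (rule ip_lap_sym)
  also have "\<dots> = l * ip n x y"
    unfolding ip_scale_left[symmetric] using assms by (intro ip_cong) (auto simp: lap_eigenvector_def)
  finally show ?thesis using assms(3) by simp
qed

lemma lap_eigenvector_combination:
  assumes "\<And>a. a \<in> A \<Longrightarrow> lap_eigenvector n E l (f a)"
  shows "lap_eigenvector n E l (\<lambda>i. \<Sum>a\<in>A. c a * f a i)"
  unfolding lap_eigenvector_def
proof (intro allI impI)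
  fix i assume i: "i < n"
  have "lap_apply n E (\<lambda>i. \<Sum>a\<in>A. c a * f a i) i
      = (\<Sum>j | j < n \<and> E i j. \<Sum>a\<in>A. c a * (f a i - f a j))"
    by (simp add: lap_apply_def sum_subtractf right_diff_distrib)
  also have "\<dots> = (\<Sum>a\<in>A. c a * lap_apply n E (f a) i)"
    unfolding lap_apply_def sum_distrib_left by (rule sum.swap)
  also have "\<dots> = l * (\<Sum>a\<in>A. c a * f a i)"
    using assms i by (simp add: lap_eigenvector_def sum_distrib_left algebra_simps)
  finally show "lap_apply n E (\<lambda>i. \<Sum>a\<in>A. c a * f a i) i = l * (\<Sum>a\<in>A. c a * f a i)" .
qed

text \<open>If the basis vectors for \<open>l\<close> outnumbered \<open>S\<close>, a nontrivial
  combination of them would vanish on \<open>S\<close>, hence everywhere, against their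
  independence.\<close>

lemma lap_mult_le_card:
  assumes "finite S" "S \<subseteq> {..<n}"
    and det: "\<And>z. lap_eigenvector n E l z \<Longrightarrow> \<forall>s\<in>S. z s = 0 \<Longrightarrow> \<forall>i<n. z i = 0"
  shows "lap_mult n E l \<le> card S"
proof (rule ccontr)
  assume "\<not> lap_mult n E l \<le> card S"
  obtain u d where on: "\<And>i j. i < n \<Longrightarrow> j < n \<Longrightarrow> ip n (u i) (u j) = (if i = j then 1 else 0)"
    and ev: "\<And>i. i < n \<Longrightarrow> lap_eigenvector n E (d i) (u i)"
    and pr: "proots (char_poly (laplacian n E)) = image_mset d (mset_set {..<n})"
    by (rule lap_orthonormal_eigenbasis) blast
  define I where "I = {i\<in>{..<n}. d i = l}"
  have "lap_mult n E l = card I"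
    by (simp add: lap_mult_def pr I_def count_image_mset_eq_card_vimage)
  then obtain c where c: "\<exists>i\<in>I. c i \<noteq> 0" "\<forall>s\<in>S. (\<Sum>i\<in>I. u i s * c i) = 0"
    using underdetermined_system_nontrivial_solution[of S I "\<lambda>s i. u i s"] assms(1)
      \<open>\<not> lap_mult n E l \<le> card S\<close> by (auto simp: I_def)
  define z where "z a = (\<Sum>i\<in>I. c i * u i a)" for a
  have ez: "lap_eigenvector n E l z"
    unfolding z_def by (rule lap_eigenvector_combination) (use ev in \<open>auto simp: I_def\<close>)
  have "\<forall>s\<in>S. z s = 0" using c(2) by (simp add: z_def mult.commute)
  with ez have z0: "\<forall>i<n. z i = 0" by (rule det)
  have "c i = 0" if "i \<in> I" for i
  proof -
    have "0 = ip n z (u i)" using z0 by (simp add: ip_def)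
    also have "\<dots> = (\<Sum>j\<in>I. c j * ip n (u j) (u i))"
      unfolding z_def by (simp only: ip_sum_left ip_scale_left)
    also have "\<dots> = (\<Sum>j\<in>I. if j = i then c j else 0)"
      using that by (intro sum.cong) (auto simp: on I_def)
    also have "\<dots> = c i" using that by (simp add: I_def)
    finally show ?thesis by simp
  qed
  then show False using c(1) by blast
qed

text \<open>The values on \<open>S\<close> make the \<open>f s\<close> independent. If they
  outnumbered the basis vectors for \<open>l\<close>, a nontrivial combination would be orthogonal
  to these; it is orthogonal to the remaining basis vectors anyway, hence zero.\<close>

lemma card_le_lap_mult:
  assumes "finite S" "S \<subseteq> {..<n}"
    and ef: "\<And>s. s \<in> S \<Longrightarrow> lap_eigenvector n E l (f s)"
    and delta: "\<And>s t. s \<in> S \<Longrightarrow> t \<in> S \<Longrightarrow> f s t = (if s = t then 1 else 0)"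
  shows "card S \<le> lap_mult n E l"
proof (rule ccontr)
  assume "\<not> card S \<le> lap_mult n E l"
  obtain u d where on: "\<And>i j. i < n \<Longrightarrow> j < n \<Longrightarrow> ip n (u i) (u j) = (if i = j then 1 else 0)"
    and ev: "\<And>i. i < n \<Longrightarrow> lap_eigenvector n E (d i) (u i)"
    and complete: "\<And>x a. a < n \<Longrightarrow> x a = (\<Sum>i<n. ip n x (u i) * u i a)"
    and pr: "proots (char_poly (laplacian n E)) = image_mset d (mset_set {..<n})"
    by (rule lap_orthonormal_eigenbasis) blast
  define I where "I = {i\<in>{..<n}. d i = l}"
  have "lap_mult n E l = card I"
    by (simp add: lap_mult_def pr I_def count_image_mset_eq_card_vimage)
  then obtain c where c: "\<exists>s\<in>S. c s \<noteq> 0" "\<forall>i\<in>I. (\<Sum>s\<in>S. ip n (f s) (u i) * c s) = 0"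
    using underdetermined_system_nontrivial_solution[of I S "\<lambda>i s. ip n (f s) (u i)"] assms(1)
      \<open>\<not> card S \<le> lap_mult n E l\<close> by (auto simp: I_def)
  define z where "z a = (\<Sum>s\<in>S. c s * f s a)" for a
  have ez: "lap_eigenvector n E l z"
    unfolding z_def by (rule lap_eigenvector_combination) (use ef in auto)
  have "ip n z (u i) = 0" if "i < n" for i
  proof (cases "d i = l")
    case True
    then show ?thesis using c(2) that
      unfolding z_def by (simp add: ip_sum_left ip_scale_left I_def mult.commute)
  next
    case False
    then show ?thesis using lap_eigenvector_orthogonal[OF ez ev[OF that]] by auto
  qed
  then have z0: "z a = 0" if "a < n" for a by (subst complete[OF that]) simp
  have "c s = 0" if "s \<in> S" for s
  proof -
    have "0 = z s" using z0 that assms(2) by auto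
    also have "\<dots> = (\<Sum>t\<in>S. if t = s then c t else 0)"
      unfolding z_def using that by (intro sum.cong) (auto simp: delta)
    also have "\<dots> = c s" using that assms(1) by simp
    finally show ?thesis by simp
  qed
  then show False using c(1) by blast
qed

end

section \<open>Algebraic connectivity as a minimal Rayleigh quotient\<close>

locale conn_graph = simple_graph +
  assumes connected: "connected_graph n E" and two_le: "2 \<le> n"
begin

lemma adj_closed_imp_all:
  assumes "P a" "a < n" "\<And>i j. P i \<Longrightarrow> E i j \<Longrightarrow> P j" "b < n"
  shows "P b"
proof -
  have "E\<^sup>*\<^sup>* a b" using connected assms by (auto simp: connected_graph_def)
  then show ?thesis by (induction rule: rtranclp_induct) (use assms in auto)
qed

text \<open>The form is a sum of squared differences along edges, so it vanishes only if
  \<open>x\<close> agrees across every edge.\<close>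

lemma lap_kernel_const:
  assumes "ip n x (lap_apply n E x) = 0" "a < n" "b < n"
  shows "x a = x b"
proof -
  have "(\<Sum>i<n. \<Sum>j | j < n \<and> E i j. (x i - x j)\<^sup>2) = 0"
    using ip_lap_self[of x] assms by simp
  then have e: "x i = x j" if "E i j" for i j
    using that adj_less[OF that] by (auto simp: sum_nonneg_eq_0_iff sum_nonneg)
  show ?thesis
    by (rule adj_closed_imp_all[of "\<lambda>i. x a = x i" a b]) (use assms e in metis)+
qed

text \<open>Courant-Fischer for the second eigenvalue, read off in an orthonormal eigenbasis: by
  connectedness exactly one index \<open>i0\<close> has eigenvalue 0, its vector is constant, and
  zero sum means orthogonality to it.\<close>

lemma algebraic_connectivity:
  shows "0 < lap_mu n E 2"
    and "\<exists>z. lap_eigenvector n E (lap_mu n E 2) z \<and> (\<exists>i<n. z i \<noteq> 0)"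
    and "\<And>x. (\<Sum>i<n. x i) = 0 \<Longrightarrow> lap_mu n E 2 * ip n x x \<le> ip n x (lap_apply n E x)"
    and "\<And>x. (\<Sum>i<n. x i) = 0 \<Longrightarrow> ip n x (lap_apply n E x) = lap_mu n E 2 * ip n x x \<Longrightarrow>
           lap_eigenvector n E (lap_mu n E 2) x"
proof -
  obtain u d where on: "\<And>i j. i < n \<Longrightarrow> j < n \<Longrightarrow> ip n (u i) (u j) = (if i = j then 1 else 0)"
    and ev: "\<And>i. i < n \<Longrightarrow> lap_eigenvector n E (d i) (u i)"
    and complete: "\<And>x a. a < n \<Longrightarrow> x a = (\<Sum>i<n. ip n x (u i) * u i a)"
    and pr: "proots (char_poly (laplacian n E)) = image_mset d (mset_set {..<n})"
    by (rule lap_orthonormal_eigenbasis) blast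
  let ?mu = "lap_mu n E 2"
  have ud: "ip n x (lap_apply n E (u i)) = d i * ip n x (u i)" if "i < n" for i x
    unfolding ip_scale_right[symmetric] using ev[OF that]
    by (intro ip_cong) (auto simp: lap_eigenvector_def)
  have expand: "ip n x y = (\<Sum>i<n. ip n x (u i) * ip n y (u i))" for x y
  proof -
    have "ip n x y = ip n (\<lambda>a. \<Sum>i<n. ip n x (u i) * u i a) y"
      by (intro ip_cong) (auto simp: complete[of _ x, symmetric])
    then show ?thesis by (simp add: ip_sum_left ip_scale_left ip_commute[of n "u _" y])
  qed
  have parseval: "ip n x (lap_apply n E x) = (\<Sum>i<n. d i * (ip n x (u i))\<^sup>2)" for x
    by (subst expand) (auto simp: ip_lap_sym[symmetric] ud power2_eq_square intro!: sum.cong)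
  have dn: "0 \<le> d i" if "i < n" for i
  proof -
    have "0 \<le> ip n (u i) (lap_apply n E (u i))"
      using ip_lap_self[of "u i"] by (smt (verit) sum_nonneg zero_le_power2)
    then show ?thesis using that by (simp add: ud on)
  qed
  \<comment> \<open>Otherwise the constant vector, an eigenvector for 0, would be orthogonal to the
    whole basis.\<close>
  have "\<exists>i<n. d i = 0"
  proof (rule ccontr)
    assume "\<not> (\<exists>i<n. d i = 0)"
    have one: "lap_eigenvector n E 0 (\<lambda>_. 1)" by (simp add: lap_eigenvector_def lap_apply_def)
    have "ip n (\<lambda>_. 1) (u i) = 0" if "i < n" for i
      using lap_eigenvector_orthogonal[OF one ev[OF that]] \<open>\<not> (\<exists>i<n. d i = 0)\<close> that by auto
    then have "(1::real) = 0" using complete[of 0 "\<lambda>_. 1"] two_le by simp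
    then show False by simp
  qed
  then obtain i0 where i0: "i0 < n" "d i0 = 0" by auto
  define c where "c i = u i 0" for i
  have const: "u i a = c i" if "i < n" "d i = 0" "a < n" for i a
    using lap_kernel_const[of "u i" a 0] that two_le by (simp add: ud c_def)
  \<comment> \<open>Two basis vectors for 0 would both be constant and nonzero, so they could not be
    orthogonal.\<close>
  have dpos: "0 < d i" if "i < n" "i \<noteq> i0" for i
  proof (rule ccontr)
    assume "\<not> 0 < d i"
    then have "d i = 0" using dn[OF that(1)] by simp
    then have *: "ip n (u i) y = c i * (\<Sum>a<n. y a)" "ip n (u i0) y = c i0 * (\<Sum>a<n. y a)" for y
      unfolding ip_def sum_distrib_left using const that i0 by (auto intro!: sum.cong)
    show False
      using on[of i i0] on[of i i] on[of i0 i0] i0 that unfolding * by auto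
  qed
  define M where "M = image_mset d (mset_set ({..<n} - {i0}))"
  have "mset_set {..<n} = add_mset i0 (mset_set ({..<n} - {i0}))"
    using i0 by (intro mset_set.remove) auto
  then have "proots (char_poly (laplacian n E)) = add_mset 0 M"
    by (simp add: pr M_def i0)
  moreover have Mpos: "\<forall>x\<in>#M. 0 < x" using dpos by (auto simp: M_def)
  \<comment> \<open>All members of \<open>M\<close> are positive, so 0 heads the sorted list and the
    entry at position \<open>2 - 1\<close> is the least member of \<open>M\<close>.\<close>
  ultimately have "lap_eigenvalues n E = 0 # sorted_list_of_multiset M"
    by (auto simp: lap_eigenvalues_def less_imp_le intro: insort_is_Cons)
  then have mu: "?mu = sorted_list_of_multiset M ! 0" by (simp add: lap_mu_def)
  have "M \<noteq> {#}"
  proof -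
    have "size M = n - 1" using i0 by (simp add: M_def)
    then show ?thesis using two_le by auto
  qed
  then obtain y ys where L: "sorted_list_of_multiset M = y # ys"
    by (cases "sorted_list_of_multiset M") (auto, metis mset_sorted_list_of_multiset mset.simps(1))
  have setM: "set_mset M = insert y (set ys)"
    by (metis L list.simps(15) set_sorted_list_of_multiset)
  have "sorted (y # ys)" using sorted_sorted_list_of_multiset[of M] by (simp add: L)
  then have min: "?mu \<in># M" "\<And>x. x \<in># M \<Longrightarrow> ?mu \<le> x" by (auto simp: mu L setM)
  show mupos: "0 < ?mu" using min(1) Mpos by auto
  from min(1) have "?mu \<in> d ` ({..<n} - {i0})" by (simp add: M_def)
  then obtain i1 where "i1 \<in> {..<n} - {i0}" "?mu = d i1" by (rule imageE)
  then have i1: "i1 < n" "i1 \<noteq> i0" "d i1 = ?mu" by auto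
  have le: "?mu \<le> d i" if "i < n" "i \<noteq> i0" for i
    using that by (intro min(2)) (auto simp: M_def)
  have "\<exists>a<n. u i1 a \<noteq> 0" using on[of i1 i1] i1 by (auto simp: ip_def intro: ccontr)
  then show "\<exists>z. lap_eigenvector n E ?mu z \<and> (\<exists>i<n. z i \<noteq> 0)"
    using ev[OF i1(1)] i1 by auto
  fix x :: "nat \<Rightarrow> real" assume x: "(\<Sum>i<n. x i) = 0"
  have "ip n x (u i0) = c i0 * (\<Sum>i<n. x i)"
    unfolding ip_def sum_distrib_left using const i0 by (auto intro!: sum.cong)
  then have c0: "ip n x (u i0) = 0" by (simp add: x)
  \<comment> \<open>The summands are nonnegative: only \<open>i0\<close> can have \<open>d i\<close>
    below \<open>?mu\<close>, and there the coefficient of \<open>x\<close> is zero. If the sum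
    vanishes, \<open>x\<close> has components only at the eigenvalue \<open>?mu\<close>.\<close>
  have diff: "ip n x (lap_apply n E x) - ?mu * ip n x x = (\<Sum>i<n. (d i - ?mu) * (ip n x (u i))\<^sup>2)"
    unfolding parseval by (subst expand)
      (simp add: sum_distrib_left sum_subtractf left_diff_distrib power2_eq_square)
  have nonneg: "0 \<le> (d i - ?mu) * (ip n x (u i))\<^sup>2" if "i < n" for i
    using le[OF that] c0 by (cases "i = i0") auto
  then have "0 \<le> (\<Sum>i<n. (d i - ?mu) * (ip n x (u i))\<^sup>2)" by (intro sum_nonneg) auto
  then show "?mu * ip n x x \<le> ip n x (lap_apply n E x)" using diff by simp
  assume "ip n x (lap_apply n E x) = ?mu * ip n x x"
  then have "(\<Sum>i<n. (d i - ?mu) * (ip n x (u i))\<^sup>2) = 0" using diff by simp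
  then have z: "(d i - ?mu) * (ip n x (u i))\<^sup>2 = 0" if "i < n" for i
    using nonneg that by (subst (asm) sum_nonneg_eq_0_iff) auto
  have "ip n (lap_apply n E x) (u i) = ?mu * ip n x (u i)" if "i < n" for i
    using z[OF that] ip_lap_sym[of x "u i"] ud[OF that, of x] by auto
  then show "lap_eigenvector n E ?mu x"
    unfolding lap_eigenvector_def
    by (auto simp: complete[of _ "lap_apply n E x"] complete[of _ x] sum_distrib_left algebra_simps
        intro!: sum.cong)
qed

end

section \<open>Branches of a tree\<close>

text \<open>If the new start vertex recurs on the path, everything before its later occurrence is
  cut off.\<close>

lemma rtranclp_distinct_path:
  assumes "R\<^sup>*\<^sup>* a b"
  shows "\<exists>vs. vs \<noteq> [] \<and> hd vs = a \<and> last vs = b \<and> distinct vs \<and> successively R vs"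
  using assms
proof (induction rule: converse_rtranclp_induct)
  case base
  show ?case by (rule exI[of _ "[b]"]) auto
next
  case (step a c)
  then obtain vs where vs: "vs \<noteq> []" "hd vs = c" "last vs = b" "distinct vs" "successively R vs" by auto
  show ?case
  proof (cases "a \<in> set vs")
    case True
    then obtain xs ys where "vs = xs @ a # ys" by (auto simp: in_set_conv_decomp)
    then show ?thesis
      using vs by (intro exI[of _ "a # ys"]) (auto simp: successively_append_iff)
  next
    case False
    then show ?thesis
      using vs step.hyps(1) by (intro exI[of _ "a # vs"]) (cases vs, auto)
  qed
qed

context simple_graph
begin

definition off :: "nat \<Rightarrow> nat \<Rightarrow> nat \<Rightarrow> bool" where
  "off v a b \<longleftrightarrow> E a b \<and> a \<noteq> v \<and> b \<noteq> v"

text \<open>The vertex set of the component of the graph without \<open>v\<close> that contains \<open>u\<close>.\<close>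
definition branch :: "nat \<Rightarrow> nat \<Rightarrow> nat set" where
  "branch v u = {w. (off v)\<^sup>*\<^sup>* u w}"

lemma off_rtranclp_sym: "(off v)\<^sup>*\<^sup>* a b \<Longrightarrow> (off v)\<^sup>*\<^sup>* b a"
  by (metis adj_sym off_def symp_def symp_rtranclp)

lemma branch_connected: "a \<in> branch v u \<Longrightarrow> b \<in> branch v u \<Longrightarrow> (off v)\<^sup>*\<^sup>* a b"
  unfolding branch_def using off_rtranclp_sym by (metis mem_Collect_eq rtranclp_trans)

lemma root_in_branch: "u \<in> branch v u"
  by (simp add: branch_def)

lemma branch_trans: "a \<in> branch v u \<Longrightarrow> (off v)\<^sup>*\<^sup>* a b \<Longrightarrow> b \<in> branch v u"
  unfolding branch_def by auto

lemma branch_neq: "E v u \<Longrightarrow> w \<in> branch v u \<Longrightarrow> w \<noteq> v"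
  unfolding branch_def
  by (auto elim: rtranclp.cases simp: off_def dest: adj_neq)

lemma branch_less: "E v u \<Longrightarrow> w \<in> branch v u \<Longrightarrow> w < n"
proof -
  assume u: "E v u" and "w \<in> branch v u"
  then have "(off v)\<^sup>*\<^sup>* u w" by (simp add: branch_def)
  then show ?thesis by (induction rule: rtranclp_induct) (use u adj_less(2) in \<open>auto simp: off_def\<close>)
qed

lemma branch_step: "E v u \<Longrightarrow> w \<in> branch v u \<Longrightarrow> E w p \<Longrightarrow> p \<noteq> v \<Longrightarrow> p \<in> branch v u"
  by (rule branch_trans[of w]) (auto simp: off_def branch_neq)

lemma finite_branch: "E v u \<Longrightarrow> finite (branch v u)"
  by (rule finite_subset[of _ "{..<n}"]) (auto simp: branch_less)

lemma branch_sum: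
  assumes "E v u" "\<And>i. i \<notin> branch v u \<Longrightarrow> f i = 0"
  shows "(\<Sum>i<n. f i) = (\<Sum>i\<in>branch v u. f i)"
  using assms by (intro sum.mono_neutral_right) (auto simp: branch_less)

lemma lap_apply_linear:
  "lap_apply n E (\<lambda>i. a * x i + b * y i) = (\<lambda>i. a * lap_apply n E x i + b * lap_apply n E y i)"
  unfolding lap_apply_def sum_distrib_left sum.distrib[symmetric]
  by (auto intro!: sum.cong simp: algebra_simps)

lemma lap_eigenvector_uminus: "lap_eigenvector n E l z \<Longrightarrow> lap_eigenvector n E l (\<lambda>i. - z i)"
  using lap_apply_linear[of "-1" z 0 z] by (simp add: lap_eigenvector_def)

text \<open>Where \<open>x\<close> is nonzero it equals \<open>z\<close>, and at the neighbours it
  is at least \<open>z\<close>, since these lie in the branch or are \<open>v\<close>, where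
  \<open>z\<close> vanishes. Hence \<open>lap_apply n E x\<close> is there at most
  \<open>lap_apply n E z\<close>, which is \<open>l * x\<close>.\<close>

lemma eigenvector_restrict_positive_part:
  assumes ez: "lap_eigenvector n E l z" and "E v u" "z v = 0"
  defines "x \<equiv> \<lambda>i. if i \<in> branch v u then max (z i) 0 else 0"
  shows "ip n x (lap_apply n E x) \<le> l * ip n x x"
proof -
  have "x i * lap_apply n E x i \<le> l * (x i * x i)" if i: "i < n" for i
  proof (cases "x i = 0")
    case False
    then have xi: "i \<in> branch v u" "z i > 0" "x i = z i" by (auto simp: x_def max_def split: if_splits)
    have "z j \<le> x j" if "E i j" for j
      using branch_step[OF assms(2) xi(1) that] assms(3) by (cases "j = v") (auto simp: x_def)
    then have "lap_apply n E x i \<le> lap_apply n E z i"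
      unfolding lap_apply_def by (intro sum_mono) (auto simp: xi)
    also have "\<dots> = l * x i" using ez i xi by (simp add: lap_eigenvector_def)
    finally have "x i * lap_apply n E x i \<le> x i * (l * x i)"
      using xi by (intro mult_left_mono) auto
    then show ?thesis by (simp add: algebra_simps)
  qed auto
  then show ?thesis unfolding ip_def sum_distrib_left by (intro sum_mono) auto
qed

text \<open>A discrete maximum principle: at a zero of \<open>w\<close> the entries at the
  neighbours sum to zero; being nonnegative they all vanish, and zeros spread through the
  branch.\<close>

lemma nonneg_eigenvector_branch_pos:
  assumes ew: "lap_eigenvector n E l w" and "E v u" "w v = 0"
    and nn: "\<And>i. i \<in> branch v u \<Longrightarrow> 0 \<le> w i"
    and p: "p \<in> branch v u" "0 < w p" and q: "q \<in> branch v u"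
  shows "0 < w q"
proof (rule ccontr)
  assume "\<not> 0 < w q"
  then have q0: "w q = 0" using nn[OF q] by simp
  have "(off v)\<^sup>*\<^sup>* q p" using branch_connected q p by blast
  then have "w p = 0"
  proof (induction rule: rtranclp_induct)
    case (step r s)
    have r: "r \<in> branch v u" using branch_trans[OF q step(1)] .
    have "r < n" using branch_less assms(2) r by blast
    then have "lap_apply n E w r = l * w r" using ew by (simp add: lap_eigenvector_def)
    then have "0 = (\<Sum>j | j < n \<and> E r j. w j)"
      using step.IH by (simp add: lap_apply_def sum_negf)
    moreover have "0 \<le> w j" if "E r j" for j
      using branch_step[OF assms(2) r that] nn assms(3) by (cases "j = v") auto
    ultimately have "\<forall>j\<in>{j. j < n \<and> E r j}. w j = 0"
      by (subst sum_nonneg_eq_0_iff[symmetric]) auto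
    then show ?case using step(2) adj_less(2) by (auto simp: off_def)
  qed (rule q0)
  then show False using p by simp
qed

end

section \<open>Separate branches of a tree and the characteristic vertex\<close>

locale tree = conn_graph +
  assumes acyclic: "\<not> has_cycle E"
begin

text \<open>A path avoiding \<open>v\<close> between two neighbours of \<open>v\<close> would close
  up through \<open>v\<close> to a cycle.\<close>

lemma branch_disjoint:
  assumes "E v u" "E v u'" "w \<in> branch v u" "w \<in> branch v u'"
  shows "u = u'"
proof (rule ccontr)
  assume neq: "u \<noteq> u'"
  have "(off v)\<^sup>*\<^sup>* u u'"
    using assms(3,4) off_rtranclp_sym unfolding branch_def by (metis mem_Collect_eq rtranclp_trans)
  then obtain vs where vs: "vs \<noteq> []" "hd vs = u" "last vs = u'" "distinct vs" "successively (off v) vs"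
    using rtranclp_distinct_path by metis
  obtain b ws where "vs = b # ws" using vs(1) by (cases vs) auto
  moreover from this obtain a ys where "ws = a # ys" using vs(2,3) neq by (cases ws) auto
  ultimately have vs_eq: "vs = u # a # ys" using vs(2) by simp
  have step: "off v (vs ! i) (vs ! Suc i)" if "Suc i < length vs" for i
    using vs(5) that by (simp only: successively_conv_nth)
  have "v \<notin> set vs"
  proof
    assume "v \<in> set vs"
    then obtain i where i: "i < length vs" "vs ! i = v" by (auto simp only: in_set_conv_nth)
    show False
    proof (cases "Suc i < length vs")
      case True
      then show False using step i by (auto simp: off_def)
    next
      case False
      then have "i = length vs - 1" using i(1) by linarith
      then have "vs ! i = last vs" by (simp only: last_conv_nth[OF vs(1)])
      then show False using i vs(3) assms(2) adj_neq by auto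
    qed
  qed
  then have "has_cycle E"
    unfolding has_cycle_def
  proof (intro exI[of _ "v # vs"] conjI allI impI)
    fix i assume i: "Suc i < length (v # vs)"
    show "E ((v # vs) ! i) ((v # vs) ! Suc i)"
    proof (cases i)
      case 0
      then show ?thesis using assms(1) by (simp add: vs_eq)
    next
      case (Suc k)
      then show ?thesis using step[of k] i by (auto simp: off_def)
    qed
  qed (use vs vs_eq assms(2) adj_sym in auto)
  then show False using acyclic by simp
qed

lemma branch_adj_root: "E v u \<Longrightarrow> w \<in> branch v u \<Longrightarrow> E v w \<Longrightarrow> w = u"
  using branch_disjoint[of v u w w] root_in_branch by auto

lemma branch_cover:
  assumes "v < n" "w < n" "w \<noteq> v"
  shows "\<exists>u. E v u \<and> w \<in> branch v u"
proof -
  have "w = v \<or> (\<exists>u. E v u \<and> w \<in> branch v u)"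
  proof (rule adj_closed_imp_all[of "\<lambda>w. w = v \<or> (\<exists>u. E v u \<and> w \<in> branch v u)" v])
    fix i j assume "i = v \<or> (\<exists>u. E v u \<and> i \<in> branch v u)" "E i j"
    then show "j = v \<or> (\<exists>u. E v u \<and> j \<in> branch v u)"
      using root_in_branch branch_step by blast
  qed (use assms in auto)
  then show ?thesis using assms by simp
qed

abbreviation mu :: real where "mu \<equiv> lap_mu n E 2"

text \<open>No edge joins different branches, so the norm and the quadratic form of a combination
  split. The combination with zero sum has quotient at most \<open>mu\<close> by assumption and at
  least \<open>mu\<close> by minimality, so equality holds throughout.\<close>

lemma two_branches:
  assumes u: "E v u" "E v u'" "u \<noteq> u'"
    and x: "\<And>i. i \<notin> branch v u \<Longrightarrow> x i = 0" and y: "\<And>i. i \<notin> branch v u' \<Longrightarrow> y i = 0"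
    and Qx: "ip n x (lap_apply n E x) \<le> mu * ip n x x"
    and Qy: "ip n y (lap_apply n E y) \<le> mu * ip n y y"
    and pos: "0 < (\<Sum>i<n. x i)" "0 < (\<Sum>i<n. y i)"
  shows "ip n x (lap_apply n E x) = mu * ip n x x"
    and "lap_eigenvector n E mu (\<lambda>i. (\<Sum>i<n. y i) * x i + (- (\<Sum>i<n. x i)) * y i)"
proof -
  define a where "a = (\<Sum>i<n. x i)"
  define b where "b = (\<Sum>i<n. y i)"
  define w where "w = (\<lambda>i. b * x i + (- a) * y i)"
  have disj: "x i = 0 \<or> y i = 0" for i using x y branch_disjoint[OF u(1,2)] u(3) by blast
  have "x i * y i = 0" "y i * x i = 0" for i using disj[of i] by auto
  then have xy: "ip n x y = 0" "ip n y x = 0" by (simp_all only: ip_def sum.neutral_const)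
  have "x i * lap_apply n E y i = 0" for i
  proof (cases "x i = 0")
    case False
    then have i: "i \<in> branch v u" using x by blast
    have "y j = 0" if "E i j" for j
    proof (rule ccontr)
      assume "y j \<noteq> 0"
      then have "j \<in> branch v u'" using y by blast
      then have "i \<in> branch v u'" using branch_step[OF u(2)] adj_sym that branch_neq[OF u(1) i] by blast
      then show False using branch_disjoint[OF u(1,2) i] u(3) by blast
    qed
    then show ?thesis using disj[of i] False by (simp add: lap_apply_def)
  qed auto
  then have xLy: "ip n x (lap_apply n E y) = 0" by (auto simp: ip_def intro!: sum.neutral)
  then have yLx: "ip n y (lap_apply n E x) = 0" using ip_lap_sym ip_commute by metis
  have "(\<Sum>i<n. w i) = b * a + (- a) * b"
    unfolding w_def a_def b_def sum.distrib sum_distrib_left ..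
  then have w0: "(\<Sum>i<n. w i) = 0" by simp
  have ww: "ip n w w = b\<^sup>2 * ip n x x + a\<^sup>2 * ip n y y"
    unfolding w_def ip_add_left ip_scale_left ip_add_right ip_scale_right xy
    by (simp add: power2_eq_square)
  have wLw: "ip n w (lap_apply n E w) = b\<^sup>2 * ip n x (lap_apply n E x) + a\<^sup>2 * ip n y (lap_apply n E y)"
    unfolding w_def lap_apply_linear ip_add_left ip_scale_left ip_add_right ip_scale_right xLy yLx
    by (simp add: power2_eq_square)
  have "b\<^sup>2 * ip n x (lap_apply n E x) \<le> b\<^sup>2 * (mu * ip n x x)"
       "a\<^sup>2 * ip n y (lap_apply n E y) \<le> a\<^sup>2 * (mu * ip n y y)"
    using Qx Qy by (auto intro: mult_left_mono)
  moreover have "mu * ip n w w \<le> ip n w (lap_apply n E w)" by (rule algebraic_connectivity(3)[OF w0])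
  moreover have "mu * ip n w w = b\<^sup>2 * (mu * ip n x x) + a\<^sup>2 * (mu * ip n y y)"
    by (simp add: ww algebra_simps)
  ultimately have eq: "ip n w (lap_apply n E w) = mu * ip n w w"
    "b\<^sup>2 * ip n x (lap_apply n E x) = b\<^sup>2 * (mu * ip n x x)"
    unfolding wLw by linarith+
  show "ip n x (lap_apply n E x) = mu * ip n x x"
    using eq(2) pos by (simp add: b_def)
  show "lap_eigenvector n E mu (\<lambda>i. (\<Sum>i<n. y i) * x i + (- (\<Sum>i<n. x i)) * y i)"
    using algebraic_connectivity(4)[OF w0 eq(1)] by (simp add: w_def a_def b_def)
qed

text \<open>One linear condition leaves a nonzero vector in an eigenspace of dimension at least 2,
  so some eigenvector vanishes at vertex 0. On the way from there to a nonzero entry, some edge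
  joins a zero to a nonzero entry.\<close>

lemma eigenvector_zero_vertex:
  assumes "2 \<le> lap_mult n E l"
  obtains z v u where "lap_eigenvector n E l z" "E v u" "z v = 0" "z u \<noteq> 0"
proof -
  have "\<not> lap_mult n E l \<le> card {0::nat}" using assms by simp
  then obtain z i where z: "lap_eigenvector n E l z" "z 0 = 0" "i < n" "z i \<noteq> 0"
    using lap_mult_le_card[of "{0}" l] two_le by fastforce
  have "\<exists>v u. E v u \<and> z v = 0 \<and> z u \<noteq> 0"
  proof (rule ccontr)
    assume "\<not> ?thesis"
    then have "z i = 0"
      using z two_le by (intro adj_closed_imp_all[of "\<lambda>j. z j = 0" 0 i]) auto
    then show False using z by simp
  qed
  then show thesis using that z by blast
qed

text \<open>The equation at \<open>v\<close> makes the entries at its neighbours sum to zero.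
  Applied to the negated vector this also gives a positive neighbour.\<close>

lemma eigenvector_neighbour_signs:
  assumes "lap_eigenvector n E l z" "E v u" "z v = 0" "z u \<noteq> 0"
  shows "\<exists>u'. E v u' \<and> z u' < 0"
proof (rule ccontr)
  assume "\<not> ?thesis"
  then have nn: "\<forall>j\<in>{j. j < n \<and> E v j}. 0 \<le> z j" by fastforce
  have "lap_apply n E z v = l * z v"
    using assms(1) adj_less(1)[OF assms(2)] by (simp add: lap_eigenvector_def)
  then have "(\<Sum>j | j < n \<and> E v j. z j) = 0"
    using assms(3) by (simp add: lap_apply_def sum_negf)
  then have "\<forall>j\<in>{j. j < n \<and> E v j}. z j = 0"
    using nn by (subst (asm) sum_nonneg_eq_0_iff) auto
  then show False using assms adj_less by auto
qed

text \<open>Fiedler's characteristic vertex: the positive and negative parts of an eigenvector vanishing at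
  \<open>v\<close>, cut down to two branches, both attain the minimal Rayleigh quotient.\<close>

lemma characteristic_vertex_exists:
  assumes "2 \<le> lap_mult n E mu"
  obtains v u1 u2 w where "E v u1" "E v u2" "u1 \<noteq> u2" "lap_eigenvector n E mu w"
    "\<And>i. i \<in> branch v u1 \<Longrightarrow> 0 < w i" "\<And>i. i \<in> branch v u2 \<Longrightarrow> w i < 0"
    "\<And>i. i \<notin> branch v u1 \<Longrightarrow> i \<notin> branch v u2 \<Longrightarrow> w i = 0"
proof -
  obtain z v u where z: "lap_eigenvector n E mu z" "E v u" "z v = 0" "z u \<noteq> 0"
    using eigenvector_zero_vertex[OF assms] by metis
  note z' = lap_eigenvector_uminus[OF z(1)]
  obtain u2 where u2: "E v u2" "z u2 < 0" using eigenvector_neighbour_signs[OF z] by auto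
  have "\<exists>u'. E v u' \<and> - z u' < 0" using eigenvector_neighbour_signs[OF z' z(2)] z by auto
  then obtain u1 where u1: "E v u1" "z u1 > 0" by auto
  have neq: "u1 \<noteq> u2" using u1 u2 by auto
  define x where "x i = (if i \<in> branch v u1 then max (z i) 0 else 0)" for i
  define y where "y i = (if i \<in> branch v u2 then max (- z i) 0 else 0)" for i
  have Qx: "ip n x (lap_apply n E x) \<le> mu * ip n x x"
    unfolding x_def[abs_def] by (rule eigenvector_restrict_positive_part[OF z(1) u1(1) z(3)])
  have Qy: "ip n y (lap_apply n E y) \<le> mu * ip n y y"
    unfolding y_def[abs_def]
    by (rule eigenvector_restrict_positive_part[OF z' u2(1)]) (simp add: z)
  have "0 < x u1" using u1 root_in_branch by (simp add: x_def)
  then have sx: "0 < (\<Sum>i<n. x i)"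
    using u1 adj_less by (intro sum_pos2[of _ u1]) (auto simp: x_def)
  have "0 < y u2" using u2 root_in_branch by (simp add: y_def)
  then have sy: "0 < (\<Sum>i<n. y i)"
    using u2 adj_less by (intro sum_pos2[of _ u2]) (auto simp: y_def)
  define w where "w = (\<lambda>i. (\<Sum>i<n. y i) * x i + (- (\<Sum>i<n. x i)) * y i)"
  have ew: "lap_eigenvector n E mu w"
    unfolding w_def
    by (rule two_branches(2)[OF u1(1) u2(1) neq _ _ Qx Qy sx sy]) (auto simp: x_def y_def)
  have y0: "y i = 0" if "i \<in> branch v u1" for i
    using that branch_disjoint[OF u1(1) u2(1)] neq by (auto simp: y_def)
  have x0: "x i = 0" if "i \<in> branch v u2" for i
    using that branch_disjoint[OF u1(1) u2(1)] neq by (auto simp: x_def)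
  have wv: "w v = 0" using branch_neq u1 u2 by (auto simp: w_def x_def y_def)
  \<comment> \<open>On the first branch \<open>w\<close> is a positive multiple of \<open>x\<close>,
    on the second a negative multiple of \<open>y\<close>; as an eigenvector of one sign on each, it
    has no zeros there.\<close>
  show thesis
  proof (rule that[OF u1(1) u2(1) neq ew])
    fix i assume i: "i \<in> branch v u1"
    show "0 < w i"
      by (rule nonneg_eigenvector_branch_pos[OF ew u1(1) wv _ root_in_branch _ i])
        (use sx sy \<open>0 < x u1\<close> y0 root_in_branch in \<open>auto simp: w_def x_def\<close>)
  next
    fix i assume i: "i \<in> branch v u2"
    have "0 < - w i"
      by (rule nonneg_eigenvector_branch_pos[OF lap_eigenvector_uminus[OF ew] u2(1) _ _ root_in_branch _ i])
        (use sx sy \<open>0 < y u2\<close> x0 root_in_branch wv u2(2) in \<open>auto simp: w_def y_def mult_less_0_iff\<close>)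
    then show "w i < 0" by simp
  qed (auto simp: w_def x_def y_def)
qed

end

section \<open>Eigenvectors seen from a characteristic vertex\<close>

locale characteristic_vertex = tree +
  fixes v u1 u2 :: nat and w :: "nat \<Rightarrow> real"
  assumes u1: "E v u1" and u2: "E v u2" and u12: "u1 \<noteq> u2"
    and ew: "lap_eigenvector n E mu w"
    and wpos: "\<And>i. i \<in> branch v u1 \<Longrightarrow> 0 < w i"
    and wneg: "\<And>i. i \<in> branch v u2 \<Longrightarrow> w i < 0"
    and wzero: "\<And>i. i \<notin> branch v u1 \<Longrightarrow> i \<notin> branch v u2 \<Longrightarrow> w i = 0"
begin

lemma w_v: "w v = 0"
  using wzero[of v] branch_neq u1 u2 by blast

text \<open>Cut down to the branch of \<open>u1\<close>, \<open>w\<close> still satisfies the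
  eigenvector equation except at \<open>v\<close>, where the defect is \<open>- w u1\<close>.
  Symmetry of the Laplacian, tested against \<open>z\<close>, forces
  \<open>z v * w u1 = 0\<close>.\<close>

lemma eigenvector_vanishes:
  assumes ez: "lap_eigenvector n E mu z"
  shows "z v = 0"
proof -
  define y where "y i = (if i \<in> branch v u1 then w i else 0)" for i
  have Ly: "lap_apply n E y i = mu * y i + (if i = v then - w u1 else 0)" if i: "i < n" for i
  proof -
    consider "i = v" | "i \<in> branch v u1" "i \<noteq> v" | "i \<notin> branch v u1" "i \<noteq> v" by blast
    then show ?thesis
    proof cases
      case 1
      have yv: "y v = 0" using branch_neq[OF u1] by (auto simp: y_def)
      have "lap_apply n E y v = (\<Sum>j | j < n \<and> E v j. if j = u1 then - w u1 else 0)"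
        unfolding lap_apply_def
        using branch_adj_root[OF u1] root_in_branch[of u1 v] by (intro sum.cong) (auto simp: yv, auto simp: y_def)
      also have "\<dots> = - w u1" using u1 adj_less by simp
      finally show ?thesis using 1 by (simp add: yv)
    next
      case 2
      have "y j = w j" if "E i j" for j
        using branch_step[OF u1 2(1) that] w_v branch_neq[OF u1, of v] by (auto simp: y_def)
      then have "lap_apply n E y i = lap_apply n E w i"
        using 2 unfolding lap_apply_def by (intro sum.cong) (auto simp: y_def)
      then show ?thesis using ew i 2 by (simp add: lap_eigenvector_def y_def)
    next
      case 3
      have "y j = 0" if "E i j" for j
        using branch_step[OF u1 _ adj_sym[OF that]] 3 by (auto simp: y_def)
      then have "lap_apply n E y i = 0"
        using 3 unfolding lap_apply_def by (intro sum.neutral) (auto simp: y_def)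
      then show ?thesis using 3 by (simp add: y_def)
    qed
  qed
  have "mu * ip n z y = ip n (lap_apply n E z) y"
    unfolding ip_scale_left[symmetric] using ez by (intro ip_cong) (auto simp: lap_eigenvector_def)
  also have "\<dots> = ip n z (lap_apply n E y)" by (simp add: ip_lap_sym)
  also have "\<dots> = ip n z (\<lambda>i. mu * y i + (if i = v then - w u1 else 0))"
    by (intro ip_cong) (auto simp: Ly)
  also have "\<dots> = mu * ip n z y + ip n z (\<lambda>i. if i = v then - w u1 else 0)"
    by (simp only: ip_add_right ip_scale_right)
  also have "ip n z (\<lambda>i. if i = v then - w u1 else 0) = - z v * w u1"
    using adj_less(1)[OF u1] by (simp add: ip_def if_distrib cong: if_cong)
  finally show ?thesis using wpos[OF root_in_branch] by simp
qed

text \<open>Supplies the second vector for \<open>two_branches\<close>: whatever \<open>u\<close>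
  is, \<open>u1\<close> or \<open>u2\<close> differs from it, and the part of \<open>w\<close> on
  that branch, up to sign, qualifies.\<close>

lemma partner_branch:
  obtains u' y where "E v u'" "u' \<noteq> u" "\<And>i. i \<notin> branch v u' \<Longrightarrow> y i = 0"
    "ip n y (lap_apply n E y) \<le> mu * ip n y y" "0 < (\<Sum>i<n. y i)"
proof (cases "u = u1")
  case False
  let ?y = "\<lambda>i. if i \<in> branch v u1 then max (w i) 0 else 0"
  have "ip n ?y (lap_apply n E ?y) \<le> mu * ip n ?y ?y"
    by (rule eigenvector_restrict_positive_part[OF ew u1 w_v])
  moreover have "0 < (\<Sum>i<n. ?y i)"
    using adj_less(2)[OF u1] wpos root_in_branch by (intro sum_pos2[of _ u1]) (auto intro: less_imp_le)
  ultimately show ?thesis using that[of u1 ?y] u1 False by auto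
next
  case True
  let ?y = "\<lambda>i. if i \<in> branch v u2 then max (- w i) 0 else 0"
  have "ip n ?y (lap_apply n E ?y) \<le> mu * ip n ?y ?y"
    by (rule eigenvector_restrict_positive_part[OF lap_eigenvector_uminus[OF ew] u2]) (simp add: w_v)
  moreover have "0 < (\<Sum>i<n. ?y i)"
    using adj_less(2)[OF u2] wneg root_in_branch by (intro sum_pos2[of _ u2]) (auto intro: less_imp_le)
  ultimately show ?thesis using that[of u2 ?y] u2 u12 True by auto
qed

text \<open>Paired with a partner branch, a quotient of at most \<open>mu\<close> must equal
  \<open>mu\<close>, so a smaller one is impossible. This makes test vectors available on a single
  branch, where the sum is not zero.\<close>

lemma branch_rayleigh_ge:
  assumes "E v u" "\<And>i. i \<notin> branch v u \<Longrightarrow> x i = 0" "0 < (\<Sum>i<n. x i)"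
  shows "mu * ip n x x \<le> ip n x (lap_apply n E x)"
proof (rule ccontr)
  assume less: "\<not> ?thesis"
  obtain u' y where y: "E v u'" "u' \<noteq> u" "\<And>i. i \<notin> branch v u' \<Longrightarrow> y i = 0"
    "ip n y (lap_apply n E y) \<le> mu * ip n y y" "0 < (\<Sum>i<n. y i)" by (rule partner_branch) blast
  have "ip n x (lap_apply n E x) = mu * ip n x x"
    by (rule two_branches(1)[OF assms(1) y(1) y(2)[symmetric] assms(2) y(3) _ y(4) assms(3) y(5)])
      (use less in auto)
  then show False using less by simp
qed

text \<open>If \<open>z\<close> had a positive entry, its positive part on the branch would enter
  \<open>two_branches\<close>. The resulting eigenvector would be positive on the whole branch, also
  at \<open>u\<close>, where it is zero.\<close>

lemma eigenvector_branch_nonpos: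
  assumes ez: "lap_eigenvector n E mu z" and u: "E v u" "z u = 0" and i: "i \<in> branch v u"
  shows "z i \<le> 0"
proof (rule ccontr)
  assume zi: "\<not> z i \<le> 0"
  define x where "x i = (if i \<in> branch v u then max (z i) 0 else 0)" for i
  have Qx: "ip n x (lap_apply n E x) \<le> mu * ip n x x"
    unfolding x_def[abs_def]
    by (rule eigenvector_restrict_positive_part[OF ez u(1) eigenvector_vanishes[OF ez]])
  have xi: "0 < x i" using zi i by (simp add: x_def)
  have sx: "0 < (\<Sum>i<n. x i)"
    using xi branch_less[OF u(1) i] by (intro sum_pos2[of _ i]) (auto simp: x_def)
  obtain u' y where y: "E v u'" "u' \<noteq> u" "\<And>i. i \<notin> branch v u' \<Longrightarrow> y i = 0"
    "ip n y (lap_apply n E y) \<le> mu * ip n y y" "0 < (\<Sum>i<n. y i)" by (rule partner_branch) blast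
  define q where "q = (\<lambda>i. (\<Sum>i<n. y i) * x i + (- (\<Sum>i<n. x i)) * y i)"
  have eq: "lap_eigenvector n E mu q"
    unfolding q_def
    by (rule two_branches(2)[OF u(1) y(1) y(2)[symmetric] _ y(3) Qx y(4) sx y(5)]) (auto simp: x_def)
  have q: "q j = (\<Sum>i<n. y i) * x j" if "j \<in> branch v u" for j
    using y(3)[of j] that branch_disjoint[OF u(1) y(1) that] y(2) by (auto simp: q_def)
  have "0 < q u"
    by (rule nonneg_eigenvector_branch_pos[OF eq u(1) eigenvector_vanishes[OF eq] _ i _ root_in_branch])
      (use y(5) xi i q in \<open>auto simp: x_def\<close>)
  then show False using q[OF root_in_branch] u(2) by (simp add: x_def root_in_branch)
qed

lemma eigenvector_branch_zero:
  assumes "lap_eigenvector n E mu z" "E v u" "z u = 0" "i \<in> branch v u"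
  shows "z i = 0"
  using eigenvector_branch_nonpos[OF assms]
    eigenvector_branch_nonpos[OF lap_eigenvector_uminus[OF assms(1)] assms(2) _ assms(4)] assms(3) by auto

text \<open>These are the roots of the branches on which some eigenvector is nonzero: by
  \<open>eigenvector_branch_zero\<close>, the value at the root decides.\<close>

definition perron_roots :: "nat set" where
  "perron_roots = {u. E v u \<and> (\<exists>z. lap_eigenvector n E mu z \<and> z u \<noteq> 0)}"

lemma finite_neighbours: "finite {u. E v u}"
  by (rule finite_subset[of _ "{..<n}"]) (auto dest: adj_less)

lemma finite_perron_roots: "finite perron_roots"
  by (rule finite_subset[OF _ finite_neighbours]) (auto simp: perron_roots_def)

lemma u1_perron: "u1 \<in> perron_roots"
  using u1 ew wpos[OF root_in_branch] by (force simp: perron_roots_def)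

lemma u2_perron: "u2 \<in> perron_roots"
  using u2 ew wneg[OF root_in_branch] by (force simp: perron_roots_def)

text \<open>An eigenvector is fixed by its values at the roots, and the equation at \<open>v\<close>
  makes these sum to zero, so the value at \<open>u1\<close> follows from the others.\<close>

lemma mult_less_perron_roots: "lap_mult n E mu < card perron_roots"
proof -
  have "lap_mult n E mu \<le> card (perron_roots - {u1})"
  proof (rule lap_mult_le_card)
    fix z assume ez: "lap_eigenvector n E mu z" and z0: "\<forall>s\<in>perron_roots - {u1}. z s = 0"
    note zv = eigenvector_vanishes[OF ez]
    have zu: "z u = 0" if "E v u" "u \<noteq> u1" for u
      using that ez z0 by (auto simp: perron_roots_def)
    have "0 = lap_apply n E z v" using ez adj_less(1)[OF u1] zv by (simp add: lap_eigenvector_def)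
    also have "\<dots> = (\<Sum>j | j < n \<and> E v j. if j = u1 then - z u1 else 0)"
      unfolding lap_apply_def using zu by (intro sum.cong) (auto simp: zv)
    also have "\<dots> = - z u1" using u1 adj_less by simp
    finally have "z u = 0" if "E v u" for u using zu that by (cases "u = u1") auto
    then show "\<forall>i<n. z i = 0"
      using branch_cover[OF adj_less(1)[OF u1]] eigenvector_branch_zero[OF ez] zv by metis
  qed (use finite_perron_roots adj_less in \<open>auto simp: perron_roots_def\<close>)
  also have "\<dots> < card perron_roots"
    using u1_perron finite_perron_roots by (intro psubset_card_mono) auto
  finally show ?thesis .
qed

text \<open>The branches are disjoint and avoid \<open>v\<close>, which accounts for the extra
  1.\<close>

lemma card_branches:
  assumes "S \<subseteq> {u. E v u}"
  shows "1 + (\<Sum>u\<in>S. card (branch v u)) \<le> n"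
proof -
  have fin: "finite S" using assms finite_neighbours finite_subset by blast
  have "(\<Sum>u\<in>S. card (branch v u)) = card (\<Union>u\<in>S. branch v u)"
    using assms finite_branch branch_disjoint fin
    by (intro card_UN_disjoint[symmetric]) blast+
  also have "\<dots> \<le> card ({..<n} - {v})"
    using assms branch_less branch_neq by (intro card_mono) blast+
  also have "\<dots> = n - 1" using adj_less(1)[OF u1] by simp
  finally show ?thesis using two_le by linarith
qed

text \<open>The test vector is \<open>1\<close> at the root of the branch and \<open>t\<close> at its other vertices.\<close>

lemma branch_test_vector:
  assumes u: "E v u" and "0 \<le> t"
  defines "p \<equiv> real (card (branch v u))"
  shows "mu * (1 + (p - 1) * t\<^sup>2) \<le> 1 + (p - 1) * (t - 1)\<^sup>2"
proof -
  let ?B = "branch v u"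
  define x where "x i = (if i = u then 1 else if i \<in> ?B then t else 0)" for i
  define C where "C = {j \<in> ?B. E u j}"
  have fin: "finite ?B" by (rule finite_branch[OF u])
  have uB: "u \<in> ?B" by (rule root_in_branch)
  have p: "real (card (?B - {u})) = p - 1" using fin uB card_gt_0_iff[of ?B] by (auto simp: p_def card_Diff_singleton of_nat_diff Suc_le_eq)
  have CB: "C \<subseteq> ?B - {u}" using adj_neq by (auto simp: C_def)
  have sumB: "(\<Sum>i<n. f i) = f u + (\<Sum>i\<in>?B - {u}. f i)" if "\<And>i. i \<notin> ?B \<Longrightarrow> f i = 0" for f :: "nat \<Rightarrow> real"
    using branch_sum[OF u that] sum.remove[OF fin uB] by simp
  have xB: "x i = 0" if "i \<notin> ?B" for i using that uB by (auto simp: x_def)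
  have "(\<Sum>i<n. x i) = x u + (\<Sum>i\<in>?B - {u}. x i)" by (rule sumB) (rule xB)
  also have "\<dots> \<ge> 1" using assms(2) by (auto simp: x_def intro!: sum_nonneg)
  finally have "0 < (\<Sum>i<n. x i)" by simp
  then have main: "mu * ip n x x \<le> ip n x (lap_apply n E x)"
    using branch_rayleigh_ge[OF u xB] by simp
  have "ip n x x = x u * x u + (\<Sum>i\<in>?B - {u}. x i * x i)"
    unfolding ip_def by (rule sumB) (simp add: xB)
  also have "(\<Sum>i\<in>?B - {u}. x i * x i) = (\<Sum>i\<in>?B - {u}. t\<^sup>2)"
    by (intro sum.cong) (auto simp: x_def power2_eq_square)
  finally have xx: "ip n x x = 1 + (p - 1) * t\<^sup>2"
    by (simp only: sum_constant p) (simp add: x_def)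
  have "{j. j < n \<and> E u j} = insert v C"
    using branch_step[OF u uB] u adj_sym adj_less by (auto simp: C_def)
  moreover have "v \<notin> C" using branch_neq[OF u] by (auto simp: C_def)
  moreover have "finite C" using fin by (auto simp: C_def)
  moreover have "x j = t" if "j \<in> C" for j using that CB by (auto simp: x_def)
  moreover have "x v = 0" using xB branch_neq[OF u] by blast
  ultimately have Lu: "lap_apply n E x u = 1 + real (card C) * (1 - t)"
    by (simp add: lap_apply_def x_def[of u])
  \<comment> \<open>\<open>v\<close> is adjacent to no vertex of the branch but \<open>u\<close>, so
    the only difference that can be nonzero is the one to \<open>u\<close>.\<close>
  have Li: "lap_apply n E x i = (if i \<in> C then t - 1 else 0)" if i: "i \<in> ?B - {u}" for i
  proof -
    have "x j = (if j = u then 1 else t)" if "E i j" for j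
      using branch_step[OF u _ that] i branch_adj_root[OF u, of i] adj_sym[OF that] by (auto simp: x_def)
    then have "lap_apply n E x i = (\<Sum>j | j < n \<and> E i j. if j = u then t - 1 else 0)"
      using i unfolding lap_apply_def by (intro sum.cong) (auto simp: x_def[of i])
    also have "\<dots> = (if i \<in> C then t - 1 else 0)"
      using i adj_less adj_sym by (auto simp: C_def)
    finally show ?thesis .
  qed
  have "ip n x (lap_apply n E x)
      = x u * lap_apply n E x u + (\<Sum>i\<in>?B - {u}. x i * lap_apply n E x i)"
    unfolding ip_def by (rule sumB) (simp add: xB)
  also have "(\<Sum>i\<in>?B - {u}. x i * lap_apply n E x i) = (\<Sum>i\<in>?B - {u}. if i \<in> C then t * (t - 1) else 0)"
    by (intro sum.cong refl) (simp add: Li, simp add: x_def)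
  also have "\<dots> = real (card C) * (t * (t - 1))"
    using CB fin by (simp add: sum.inter_restrict[symmetric] Int_absorb1)
  finally have "ip n x (lap_apply n E x) = 1 + real (card C) * (t - 1)\<^sup>2"
    by (simp add: Lu x_def[of u] power2_eq_square algebra_simps)
  \<comment> \<open>At worst all other vertices of the branch are adjacent to \<open>u\<close>; this
    leaves a bound in terms of the size alone.\<close>
  also have "\<dots> \<le> 1 + (p - 1) * (t - 1)\<^sup>2"
    using card_mono[OF _ CB] fin unfolding p[symmetric] by (intro add_left_mono mult_right_mono) auto
  finally show ?thesis using main xx by simp
qed

end

section \<open>Spiders\<close>

text \<open>The smaller eigenvalue of \<open>[[2, -1], [-1, 1]]\<close>, the block of the Laplacian that belongs to a leg of
  length two.\<close>
definition golden :: real where "golden = (3 - sqrt 5) / 2"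

lemma golden_eq: "golden\<^sup>2 = 3 * golden - 1"
  and golden_bounds: "0 < golden" "golden < 1 / 2"
proof -
  show "golden\<^sup>2 = 3 * golden - 1"
    by (simp add: golden_def power2_eq_square field_simps)
  have "2 < sqrt 5" "sqrt 5 < 3" by (simp_all add: real_less_rsqrt real_less_lsqrt)
  then show "0 < golden" "golden < 1 / 2" by (auto simp: golden_def)
qed

text \<open>The roots of the quadratic sum to 3, so the one other than \<open>golden\<close> exceeds
  1.\<close>

lemma golden_cong: "l\<^sup>2 = 3 * l - 1 \<Longrightarrow> l \<le> 1 \<Longrightarrow> l = golden"
proof -
  assume l: "l\<^sup>2 = 3 * l - 1" "l \<le> 1"
  have "(l - golden) * (l + golden - 3) = 0"
    using l(1) golden_eq by (simp add: power2_eq_square algebra_simps)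
  then show "l = golden" using l(2) golden_bounds by auto
qed

lemma lap_apply_reindex:
  assumes g: "bij_betw g {..<n} {..<n}" and e: "\<And>i j. i < n \<Longrightarrow> j < n \<Longrightarrow> E (g i) (g j) \<longleftrightarrow> E' i j"
    and i: "i < n"
  shows "lap_apply n E z (g i) = lap_apply n E' (\<lambda>j. z (g j)) i"
proof -
  have "lap_apply n E z (g i) = (\<Sum>j | j < n \<and> E (g i) j. z (g i) - z j)" by (simp add: lap_apply_def)
  also have "\<dots> = (\<Sum>j\<in>{..<n}. if E (g i) j then z (g i) - z j else 0)"
    by (simp add: sum.inter_filter[symmetric])
  also have "\<dots> = (\<Sum>j\<in>{..<n}. if E (g i) (g j) then z (g i) - z (g j) else 0)"
    by (rule sum.reindex_bij_betw[OF g, symmetric])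
  also have "\<dots> = (\<Sum>j\<in>{..<n}. if E' i j then z (g i) - z (g j) else 0)"
    using e i by (intro sum.cong) auto
  also have "\<dots> = lap_apply n E' (\<lambda>j. z (g j)) i"
    by (simp add: sum.inter_filter[symmetric] lap_apply_def)
  finally show ?thesis .
qed

lemma lap_eigenvector_reindex:
  assumes g: "bij_betw g {..<n} {..<n}" and e: "\<And>i j. i < n \<Longrightarrow> j < n \<Longrightarrow> E (g i) (g j) \<longleftrightarrow> E' i j"
  shows "lap_eigenvector n E l z \<longleftrightarrow> lap_eigenvector n E' l (\<lambda>j. z (g j))"
proof
  assume *: "lap_eigenvector n E l z"
  show "lap_eigenvector n E' l (\<lambda>j. z (g j))"
    unfolding lap_eigenvector_def
  proof (intro allI impI)
    fix i assume "i < n"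
    then show "lap_apply n E' (\<lambda>j. z (g j)) i = l * z (g i)"
      using lap_apply_reindex[where g = g and E = E and E' = E' and i = i and z = z, OF g e]
        * bij_betwE[OF g] by (simp add: lap_eigenvector_def)
  qed
next
  assume *: "lap_eigenvector n E' l (\<lambda>j. z (g j))"
  show "lap_eigenvector n E l z"
    unfolding lap_eigenvector_def
  proof (intro allI impI)
    fix a assume "a < n"
    then obtain i where "i < n" "a = g i" using g unfolding bij_betw_def by blast
    then show "lap_apply n E z a = l * z a"
      using lap_apply_reindex[where g = g and E = E and E' = E' and i = i and z = z, OF g e] * by (simp add: lap_eigenvector_def)
  qed
qed

lemma spider_neighbours:
  assumes "n = s + k + 1" "k \<le> s"
  shows "{j. j < n \<and> spider s k 0 j} = {1..s}"
    and "1 \<le> i \<Longrightarrow> i \<le> k \<Longrightarrow> {j. j < n \<and> spider s k i j} = {0, s + i}"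
    and "k < i \<Longrightarrow> i \<le> s \<Longrightarrow> {j. j < n \<and> spider s k i j} = {0}"
    and "1 \<le> i \<Longrightarrow> i \<le> k \<Longrightarrow> {j. j < n \<and> spider s k (s + i) j} = {i}"
  using assms by (auto simp: spider_def spider_arc_def)

lemma spider_lap_eigenvector_iff:
  assumes n: "n = s + k + 1" and ks: "1 \<le> k" "k \<le> s"
  shows "lap_eigenvector n (spider s k) l x \<longleftrightarrow>
      (\<Sum>i=1..s. x 0 - x i) = l * x 0 \<and>
      (\<forall>i\<in>{1..k}. (x i - x 0) + (x i - x (s + i)) = l * x i \<and> x (s + i) - x i = l * x (s + i)) \<and>
      (\<forall>i\<in>{k+1..s}. x i - x 0 = l * x i)"
proof -
  have "{..<n} = {0} \<union> {1..k} \<union> {k+1..s} \<union> (\<lambda>i. s + i) ` {1..k}"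
  proof -
    have "i \<in> (\<lambda>i. s + i) ` {1..k}" if "s < i" "i < n" for i
      using that n by (intro image_eqI[of _ _ "i - s"]) auto
    then show ?thesis using n ks by (force simp: not_le)
  qed
  then have "lap_eigenvector n (spider s k) l x \<longleftrightarrow>
      (\<forall>i\<in>{0} \<union> {1..k} \<union> {k+1..s} \<union> (\<lambda>i. s + i) ` {1..k}. lap_apply n (spider s k) x i = l * x i)"
    by (metis lap_eigenvector_def lessThan_iff)
  moreover have "lap_apply n (spider s k) x 0 = (\<Sum>i=1..s. x 0 - x i)"
    unfolding lap_apply_def spider_neighbours(1)[OF n ks(2)] ..
  moreover have "lap_apply n (spider s k) x i = (x i - x 0) + (x i - x (s + i))"
    "lap_apply n (spider s k) x (s + i) = x (s + i) - x i" if "i \<in> {1..k}" for i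
    using that spider_neighbours(2,4)[OF n ks(2), of i] by (simp_all add: lap_apply_def)
  moreover have "lap_apply n (spider s k) x i = x i - x 0" if "i \<in> {k+1..s}" for i
    using that spider_neighbours(3)[OF n ks(2), of i] by (simp add: lap_apply_def)
  ultimately show ?thesis
    by (simp only: ball_Un ball_simps(7,9) ball_empty simp_thms cong: ball_cong) blast
qed

text \<open>Solving the eigenvector equation leg by leg shows that every entry is a positive multiple of the
  entry at the centre; this is incompatible with the entries summing to zero.\<close>

lemma spider_no_small_eigenvalue:
  assumes n: "n = s + k + 1" and ks: "1 \<le> k" "k \<le> s" and l: "0 < l" "l < golden"
    and e: "lap_eigenvector n (spider s k) l x" and sum: "(\<Sum>i<n. x i) = 0" and "i < n"
  shows "x i = 0"
proof -
  note eq = e[unfolded spider_lap_eigenvector_iff[OF n ks]]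
  have l1: "l < 1" using l golden_bounds by simp
  \<comment> \<open>The characteristic polynomial of the leg block at \<open>l\<close>, positive
    below its smaller root \<open>golden\<close>. Eliminating the inner vertex of a leg gives
    \<open>q * x (s + i) = x 0\<close>.\<close>
  define q where "q = 1 - 3 * l + l\<^sup>2"
  have "q = (golden - l) * (3 - golden - l)"
    using golden_eq by (simp add: q_def power2_eq_square algebra_simps)
  also have "\<dots> > 0" using l golden_bounds by (intro mult_pos_pos) auto
  finally have q: "q > 0" .
  have mult: "\<exists>c>0. x i = c * x 0" if i: "i < n" for i
  proof -
    have leg: "x (s + i) = 1 / q * x 0 \<and> x i = (1 - l) / q * x 0" if "1 \<le> i" "i \<le> k" for i
    proof -
      have *: "(x i - x 0) + (x i - x (s + i)) = l * x i" "x (s + i) - x i = l * x (s + i)"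
        using eq that by auto
      then have a: "x i = (1 - l) * x (s + i)" by (simp add: algebra_simps)
      have "q * x (s + i) = x 0"
        using *(1) unfolding a by (simp add: q_def power2_eq_square algebra_simps)
      then have "x (s + i) = 1 / q * x 0" using q by (simp add: field_simps)
      then show ?thesis by (simp add: a)
    qed
    consider "i = 0" | "1 \<le> i" "i \<le> k" | "k < i" "i \<le> s" | "s < i" by linarith
    then show ?thesis
    proof cases
      case 1
      then show ?thesis by (intro exI[of _ 1]) auto
    next
      case 2
      then show ?thesis using leg[of i] q l1 by (intro exI[of _ "(1 - l) / q"]) auto
    next
      case 3
      then have "x i - x 0 = l * x i" using eq by auto
      then show ?thesis using l1 by (intro exI[of _ "1 / (1 - l)"]) (auto simp: field_simps)
    next
      case 4
      then have "1 \<le> i - s" "i - s \<le> k" "s + (i - s) = i" using i n by auto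
      then have "x i = 1 / q * x 0" using leg[of "i - s"] by metis
      then show ?thesis using q by (intro exI[of _ "1 / q"]) simp
    qed
  qed
  then obtain c where c: "\<And>i. i < n \<Longrightarrow> c i > 0" and cx: "\<And>i. i < n \<Longrightarrow> c i * x 0 = x i" by metis
  have "(\<Sum>i<n. c i) * x 0 = 0" unfolding sum_distrib_right using sum by (simp add: cx)
  moreover have "(\<Sum>i<n. c i) > 0" using c n by (intro sum_pos) auto
  ultimately have "x 0 = 0" by simp
  then show ?thesis using cx[OF \<open>i < n\<close>] by simp
qed

text \<open>At \<open>golden\<close> the leg block is singular, which forces the centre to zero and
  with it the short rays. The equation at the centre then determines the entry at 1 from those at
  \<open>2..k\<close>.\<close>

lemma spider_golden_eigenvector:
  assumes n: "n = s + k + 1" and ks: "1 \<le> k" "k \<le> s"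
    and e: "lap_eigenvector n (spider s k) golden x" and x0: "\<forall>i\<in>{2..k}. x i = 0" and "i < n"
  shows "x i = 0"
proof -
  note eq = e[unfolded spider_lap_eigenvector_iff[OF n ks]]
  have leg: "x i = (1 - golden) * x (s + i) \<and> x 0 = 0" if "1 \<le> i" "i \<le> k" for i
  proof -
    have *: "(x i - x 0) + (x i - x (s + i)) = golden * x i" "x (s + i) - x i = golden * x (s + i)"
      using eq that by auto
    then have a: "x i = (1 - golden) * x (s + i)" by (simp add: algebra_simps)
    have "x 0 = (golden\<^sup>2 - 3 * golden + 1) * x (s + i)"
      using *(1) unfolding a by (simp add: power2_eq_square algebra_simps)
    then show ?thesis using a golden_eq by simp
  qed
  have c0: "x 0 = 0" using leg[of 1] ks by simp
  have short: "x i = 0" if "k < i" "i \<le> s" for i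
  proof -
    have "x i - x 0 = golden * x i" using eq that by auto
    then show ?thesis using c0 golden_bounds by simp
  qed
  have "0 = (\<Sum>i=1..s. x i)" using eq c0 by (simp add: sum_negf)
  also have "\<dots> = (\<Sum>i\<in>{1..s}. if i = 1 then x 1 else 0)"
    using x0 short by (intro sum.cong) (auto simp: not_le)
  also have "\<dots> = x 1" using ks by simp
  finally have "x 1 = 0" by simp
  then have root: "x i = 0" if "1 \<le> i" "i \<le> k" for i
    using x0 that by (cases "i = 1") auto
  have "x (s + i) = 0" if "1 \<le> i" "i \<le> k" for i
    using leg[OF that] root[OF that] golden_bounds by simp
  from this[of "i - s"] show ?thesis
    using c0 short root \<open>i < n\<close> n by (cases "i = 0"; cases "i \<le> k"; cases "i \<le> s") auto
qed

text \<open>Opposite values on the legs \<open>a\<close> and \<open>1\<close>. The factor \<open>2 - golden\<close> from the inner to the outer vertex of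
  a leg comes from \<open>(2 - golden) * (1 - golden) = 1\<close>.\<close>
definition spider_vec :: "nat \<Rightarrow> nat \<Rightarrow> nat \<Rightarrow> real" where
  "spider_vec s a i = (if i = a then 1 else if i = 1 then -1 else
     if i = s + a then 2 - golden else if i = s + 1 then golden - 2 else 0)"

lemma spider_vec_eigenvector:
  assumes n: "n = s + k + 1" and ks: "1 \<le> k" "k \<le> s" and a: "a \<in> {2..k}"
  shows "lap_eigenvector n (spider s k) golden (spider_vec s a)"
  unfolding spider_lap_eigenvector_iff[OF n ks]
proof (intro conjI ballI)
  have "(\<Sum>i=1..s. spider_vec s a 0 - spider_vec s a i)
      = (\<Sum>i=1..s. (if i = 1 then 1 else 0) - (if i = a then 1 else 0))"
    using a ks by (intro sum.cong) (auto simp: spider_vec_def)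
  also have "\<dots> = 0" using a ks by (simp add: sum_subtractf)
  finally show "(\<Sum>i=1..s. spider_vec s a 0 - spider_vec s a i) = golden * spider_vec s a 0"
    using a ks by (simp add: spider_vec_def)
next
  fix i assume "i \<in> {1..k}"
  then show "(spider_vec s a i - spider_vec s a 0) + (spider_vec s a i - spider_vec s a (s + i))
      = golden * spider_vec s a i"
    and "spider_vec s a (s + i) - spider_vec s a i = golden * spider_vec s a (s + i)"
    using a ks golden_eq by (auto simp: spider_vec_def power2_eq_square algebra_simps)
next
  fix i assume "i \<in> {k+1..s}"
  then show "spider_vec s a i - spider_vec s a 0 = golden * spider_vec s a i"
    using a ks by (auto simp: spider_vec_def)
qed

section \<open>The multiplicity for graphs isomorphic to a spider\<close>

context conn_graph
begin

lemma lap_mu_le_eigenvalue: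
  assumes e: "lap_eigenvector n E l z" and "l \<noteq> 0" "i < n" "z i \<noteq> 0"
  shows "lap_mu n E 2 \<le> l"
proof -
  have "ip n z (lap_apply n E z) = l * ip n z z"
    unfolding ip_scale_right[symmetric] using e by (intro ip_cong) (auto simp: lap_eigenvector_def)
  then have "lap_mu n E 2 * ip n z z \<le> l * ip n z z"
    using algebraic_connectivity(3)[OF lap_eigenvector_sum[OF e assms(2)]] by simp
  moreover have "ip n z z \<noteq> 0" using assms by (auto simp: ip_eq_0_iff)
  then have "ip n z z > 0" using ip_nonneg[of n z] by linarith
  ultimately show ?thesis by simp
qed

text \<open>The inner vertices of the legs \<open>2..k\<close> serve for both bounds: the
  \<open>spider_vec\<close> are independent on them, and an eigenvector vanishing on them is
  zero.\<close>

lemma spider_lap_mult: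
  assumes iso: "graph_iso n E (spider s k)" and n: "n = s + k + 1" and ks: "2 \<le> k" "k \<le> s"
  shows "lap_mult n E (lap_mu n E 2) = k - 1"
proof -
  obtain f where f: "bij_betw f {..<n} {..<n}"
    and fe: "\<And>i j. i < n \<Longrightarrow> j < n \<Longrightarrow> E i j \<longleftrightarrow> spider s k (f i) (f j)"
    using iso unfolding graph_iso_def by blast
  define g where "g = inv_into {..<n} f"
  have g: "bij_betw g {..<n} {..<n}" unfolding g_def by (rule bij_betw_inv_into[OF f])
  have gn: "g i < n" if "i < n" for i using bij_betwE[OF g] that by auto
  have fg: "f (g i) = i" if "i < n" for i
    using that f unfolding g_def by (metis bij_betw_inv_into_right lessThan_iff)
  have ge: "E (g i) (g j) \<longleftrightarrow> spider s k i j" if "i < n" "j < n" for i j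
    using fe[OF gn[OF that(1)] gn[OF that(2)]] by (simp add: fg that)
  note tr = lap_eigenvector_reindex[where g = g and E = E and E' = "spider s k", OF g ge]
  have k1: "1 \<le> k" using ks by simp
  have inj: "inj_on g {..<n}" using g by (simp add: bij_betw_def)
  have fin: "\<exists>i<n. a = g i" if "a < n" for a using g that unfolding bij_betw_def by blast
  have ev: "lap_eigenvector n E golden (\<lambda>i. spider_vec s a (f i))" if "a \<in> {2..k}" for a
    using spider_vec_eigenvector[OF n k1 ks(2) that]
      lap_eigenvector_reindex[where g = f and E = "spider s k" and E' = E, OF f fe[symmetric]] by blast
  \<comment> \<open>\<open>golden\<close> is an eigenvalue, shown by the vector on the legs 1 and 2,
    and an eigenvector for a smaller positive value would be zero.\<close>
  have mu: "lap_mu n E 2 = golden"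
  proof (rule antisym)
    show "lap_mu n E 2 \<le> golden"
      by (rule lap_mu_le_eigenvalue[OF ev[of 2], of "g 2"])
        (use ks n golden_bounds gn fg in \<open>auto simp: spider_vec_def\<close>)
    show "golden \<le> lap_mu n E 2"
    proof (rule ccontr)
      assume less: "\<not> golden \<le> lap_mu n E 2"
      obtain z i where z: "lap_eigenvector n E (lap_mu n E 2) z" "i < n" "z i \<noteq> 0"
        using algebraic_connectivity(2) by blast
      obtain j where j: "j < n" "i = g j" using fin z(2) by blast
      have "(\<Sum>i<n. z (g i)) = (\<Sum>i<n. z i)" by (rule sum.reindex_bij_betw[OF g])
      also have "\<dots> = 0" using lap_eigenvector_sum[OF z(1)] algebraic_connectivity(1) by simp
      finally have "z (g j) = 0"
        using less by (intro spider_no_small_eigenvalue[OF n k1 ks(2) algebraic_connectivity(1) _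
            iffD1[OF tr z(1)] _ j(1)]) auto
      then show False using z j by simp
    qed
  qed
  let ?S = "g ` {2..k}"
  have "inj_on g {2..k}" by (rule inj_on_subset[OF inj]) (auto simp: n)
  then have card: "card ?S = k - 1" by (subst card_image) auto
  have "{2..k} \<subseteq> {..<n}" using n by auto
  then have S: "finite ?S" "?S \<subseteq> {..<n}" using gn by auto
  have "lap_mult n E golden \<le> card ?S"
  proof (rule lap_mult_le_card[OF S])
    fix z assume z: "lap_eigenvector n E golden z" "\<forall>s\<in>?S. z s = 0"
    have "z (g i) = 0" if "i < n" for i
      by (rule spider_golden_eigenvector[OF n k1 ks(2) iffD1[OF tr z(1)] _ that]) (use z(2) in auto)
    then show "\<forall>i<n. z i = 0" using fin by metis
  qed
  moreover have "card ?S \<le> lap_mult n E golden"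
  proof (rule card_le_lap_mult[OF S, of golden "\<lambda>b i. spider_vec s (f b) (f i)"])
    have S': "f b \<in> {2..k} \<and> g (f b) = b" if b: "b \<in> ?S" for b
    proof -
      obtain a where a: "a \<in> {2..k}" "b = g a" using b by blast
      then have "f b = a" using fg[of a] n by simp
      then show ?thesis using a by simp
    qed
    show "lap_eigenvector n E golden (\<lambda>i. spider_vec s (f b) (f i))" if "b \<in> ?S" for b
      using ev S'[OF that] by blast
    show "spider_vec s (f b) (f b') = (if b = b' then 1 else 0)" if "b \<in> ?S" "b' \<in> ?S" for b b'
    proof -
      have "f b = f b' \<longleftrightarrow> b = b'" using S'[OF that(1)] S'[OF that(2)] by metis
      then show ?thesis
        using S'[OF that(1)] S'[OF that(2)] ks by (auto simp: spider_vec_def)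
    qed
  qed
  ultimately show ?thesis using card mu by simp
qed

end

section \<open>Recognising a spider from the sizes of its branches\<close>

context tree
begin

lemma branch_pair:
  assumes u: "E v u" and card: "card (branch v u) = 2"
  obtains c where "branch v u = {u, c}" "c \<noteq> u" "E u c"
proof -
  from card obtain a b where ab: "branch v u = {a, b}" "a \<noteq> b" by (auto simp: card_2_iff)
  obtain c where c: "branch v u = {u, c}" "c \<noteq> u"
  proof (cases "u = a")
    case True
    then show ?thesis using that[of b] ab by simp
  next
    case False
    then show ?thesis using that[of a] ab root_in_branch[of u v] by auto
  qed
  then have "(off v)\<^sup>*\<^sup>* u c" by (auto simp: branch_def)
  then obtain b where "off v u b"
    using c(2) by (cases rule: converse_rtranclpE) auto
  then have "b \<in> branch v u" "b \<noteq> u" "E u b"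
    using adj_neq by (auto simp: off_def branch_def)
  then show thesis using that c by auto
qed

lemma small_branches_imp_spider:
  assumes v: "v < n" and small: "\<And>u. E v u \<Longrightarrow> card (branch v u) \<le> 2"
  defines "k \<equiv> card {u. E v u \<and> card (branch v u) = 2}"
  shows "\<exists>s. k \<le> s \<and> n = s + k + 1 \<and> graph_iso n E (spider s k)"
proof -
  define N where "N = {u. E v u}"
  define L where "L = {u. E v u \<and> card (branch v u) = 2}"
  have finN: "finite N" by (rule finite_subset[of _ "{..<n}"]) (auto simp: N_def dest: adj_less)
  have LN: "L \<subseteq> N" by (auto simp: L_def N_def)
  have finL: "finite L" using LN finN finite_subset by blast
  have "\<exists>c. branch v u = {u, c} \<and> c \<noteq> u \<and> E u c" if "u \<in> L" for u
    using branch_pair[of v u] that by (auto simp: L_def)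
  then obtain c where c: "\<And>u. u \<in> L \<Longrightarrow> branch v u = {u, c u} \<and> c u \<noteq> u \<and> E u (c u)" by metis
  have single: "branch v u = {u}" if "u \<in> N - L" for u
  proof -
    have "card (branch v u) \<noteq> 0"
      using that finite_branch[of v u] root_in_branch[of u v] by (auto simp: N_def card_eq_0_iff)
    then have "card (branch v u) = 1" using small that by (force simp: N_def L_def)
    then show ?thesis using root_in_branch[of u v] by (auto simp: card_1_singleton_iff)
  qed
  define s where "s = card N"
  have k: "k = card L" by (simp add: k_def L_def)
  have ks: "k \<le> s" using card_mono[OF finN LN] by (simp add: k s_def)
  have "card {1..k} = card L" "card {k+1..s} = card (N - L)"
    using card_Diff_subset[OF finL LN] by (simp_all add: k s_def)
  then obtain h1 h2 where h1: "bij_betw h1 {1..k} L" and h2: "bij_betw h2 {k+1..s} (N - L)"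
    using finL finN by (metis finite_Diff finite_atLeastAtMost finite_same_card_bij)
  \<comment> \<open>The labels follow \<open>spider\<close>: 0 is the centre \<open>v\<close>, then
    come the roots of the two-vertex branches, then the single vertices; \<open>s + i\<close> is the
    outer vertex of leg \<open>i\<close>.\<close>
  define g where "g i = (if i = 0 then v else if i \<le> k then h1 i else if i \<le> s then h2 i
    else c (h1 (i - s)))" for i
  have injc: "inj_on c L"
  proof
    fix a b assume ab: "a \<in> L" "b \<in> L" "c a = c b"
    have "E v a" "E v b" using ab(1,2) by (simp_all add: L_def)
    moreover have "c a \<in> branch v a" "c a \<in> branch v b"
      using c[OF ab(1)] c[OF ab(2)] ab(3) by simp_all
    ultimately show "a = b" by (rule branch_disjoint)
  qed
  have cN: "c u \<notin> N" "c u \<noteq> v" if "u \<in> L" for u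
  proof -
    have u: "E v u" "c u \<in> branch v u" "c u \<noteq> u" using that c[OF that] by (simp_all add: L_def)
    show "c u \<notin> N" using branch_adj_root[OF u(1,2)] u(3) by (auto simp: N_def)
    show "c u \<noteq> v" by (rule branch_neq[OF u(1,2)])
  qed
  have bij0: "bij_betw g {0} {v}" by (simp add: g_def bij_betw_def)
  have bij1: "bij_betw g {1..k} L"
    using h1 by (rule bij_betw_cong[THEN iffD1, rotated]) (auto simp: g_def)
  have bij2: "bij_betw g {k+1..s} (N - L)"
    using h2 by (rule bij_betw_cong[THEN iffD1, rotated]) (auto simp: g_def)
  have "bij_betw (\<lambda>i. i - s) {s+1..s+k} {1..k}"
    by (rule bij_betwI[of _ _ _ "\<lambda>i. i + s"]) auto
  then have "bij_betw (c \<circ> (h1 \<circ> (\<lambda>i. i - s))) {s+1..s+k} (c ` L)"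
    by (intro bij_betw_trans[OF bij_betw_trans[OF _ h1]]) (use injc in \<open>auto simp: bij_betw_def\<close>)
  then have bij3: "bij_betw g {s+1..s+k} (c ` L)"
    by (rule bij_betw_cong[THEN iffD1, rotated]) (use ks in \<open>auto simp: g_def\<close>)
  have "bij_betw g ({1..k} \<union> {k+1..s}) (L \<union> (N - L))"
    by (rule bij_betw_combine[OF bij1 bij2]) auto
  moreover have "{1..k} \<union> {k+1..s} = {1..s}" "L \<union> (N - L) = N" using ks LN by auto
  ultimately have bijN: "bij_betw g {1..s} N" by simp
  have "bij_betw g ({0} \<union> {1..s}) ({v} \<union> N)"
    by (rule bij_betw_combine[OF bij0 bijN]) (auto simp: N_def dest: adj_neq)
  then have "bij_betw g ({0} \<union> {1..s} \<union> {s+1..s+k}) ({v} \<union> N \<union> c ` L)"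
    by (rule bij_betw_combine[OF _ bij3]) (use cN in auto)
  moreover have "{0} \<union> {1..s} \<union> {s+1..s+k} = {..<s+k+1}" by auto
  moreover have "{v} \<union> N \<union> c ` L = {..<n}"
  proof
    have "c u < n" if "u \<in> L" for u using c[OF that] adj_less(2) by blast
    then show "{v} \<union> N \<union> c ` L \<subseteq> {..<n}" using v adj_less(2) by (auto simp: N_def)
    show "{..<n} \<subseteq> {v} \<union> N \<union> c ` L"
    proof
      fix x assume "x \<in> {..<n}"
      then have "x = v \<or> (\<exists>u. E v u \<and> x \<in> branch v u)" using branch_cover[OF v] by auto
      then show "x \<in> {v} \<union> N \<union> c ` L"
      proof (elim disjE exE conjE)
        fix u assume u: "E v u" "x \<in> branch v u"
        show ?thesis
          using u c[of u] single[of u] by (cases "u \<in> L") (auto simp: N_def)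
      qed auto
    qed
  qed
  ultimately have g: "bij_betw g {..<s+k+1} {..<n}" by simp
  have n: "n = s + k + 1" using bij_betw_same_card[OF g] by simp
  have inj: "g a = g b \<longleftrightarrow> a = b" if "a < n" "b < n" for a b
    using g that n by (auto simp: bij_betw_def inj_on_def)
  \<comment> \<open>An edge that avoids \<open>v\<close> stays inside one branch, so it joins the
    two vertices of a long leg.\<close>
  have adj: "E x y \<longleftrightarrow> (x = v \<and> y \<in> N) \<or> (y = v \<and> x \<in> N) \<or> (x \<in> L \<and> y = c x) \<or> (y \<in> L \<and> x = c y)"
    for x y
  proof
    assume xy: "E x y"
    show "(x = v \<and> y \<in> N) \<or> (y = v \<and> x \<in> N) \<or> (x \<in> L \<and> y = c x) \<or> (y \<in> L \<and> x = c y)"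
    proof (cases "x = v \<or> y = v")
      case True
      then show ?thesis using xy adj_sym by (auto simp: N_def)
    next
      case False
      then obtain u where u: "E v u" "x \<in> branch v u"
        using branch_cover[OF v adj_less(1)[OF xy]] by auto
      then have "y \<in> branch v u" using branch_step xy False by blast
      then show ?thesis
        using u xy adj_neq[OF xy] c[of u] single[of u] by (cases "u \<in> L") (auto simp: N_def)
    qed
  qed (use c adj_sym in \<open>auto simp: N_def\<close>)
  have gv: "g a = v \<longleftrightarrow> a = 0" if "a < n" for a
    using inj[OF that, of 0] n by (auto simp: g_def)
  have image: "g a \<in> g ` A \<longleftrightarrow> a \<in> A" if "a < n" "A \<subseteq> {..<n}" for a A
    using inj that by (auto simp: subset_iff)
  have gN: "g a \<in> N \<longleftrightarrow> 1 \<le> a \<and> a \<le> s" if "a < n" for a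
  proof -
    have "{1..s} \<subseteq> {..<n}" using n by auto
    from image[OF that this] show ?thesis using bij_betw_imp_surj_on[OF bijN] by simp
  qed
  have gL: "g a \<in> L \<longleftrightarrow> 1 \<le> a \<and> a \<le> k" if "a < n" for a
  proof -
    have "{1..k} \<subseteq> {..<n}" using n by auto
    from image[OF that this] show ?thesis using bij_betw_imp_surj_on[OF bij1] by simp
  qed
  have gc: "g b = c (g a) \<longleftrightarrow> b = s + a" if "1 \<le> a" "a \<le> k" "b < n" for a b
  proof -
    have "c (g a) = g (s + a)" using that ks by (simp add: g_def)
    then show ?thesis using inj[OF that(3), of "s + a"] that n by auto
  qed
  have sp: "E (g a) (g b) \<longleftrightarrow> spider s k a b" if "a < n" "b < n" for a b
    unfolding adj spider_def spider_arc_def gv[OF that(1)] gv[OF that(2)] gN[OF that(1)] gN[OF that(2)]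
      gL[OF that(1)] gL[OF that(2)]
    using gc[of a b] gc[of b a] that by blast
  define f where "f = inv_into {..<n} g"
  have g': "bij_betw g {..<n} {..<n}" using g n by simp
  have f: "bij_betw f {..<n} {..<n}" unfolding f_def by (rule bij_betw_inv_into[OF g'])
  have gf: "g (f x) = x" if "x < n" for x
    using that g' unfolding f_def by (metis bij_betw_inv_into_right lessThan_iff)
  have "E x y \<longleftrightarrow> spider s k (f x) (f y)" if "x < n" "y < n" for x y
    using sp[of "f x" "f y"] bij_betwE[OF f] that by (simp add: gf)
  then have "graph_iso n E (spider s k)" using f by (auto simp: graph_iso_def)
  then show ?thesis using ks n by blast
qed

end

section \<open>Sizes of the branches when the multiplicity is large\<close>

context characteristic_vertex
begin

lemma branch_card_pos: "E v u \<Longrightarrow> 1 \<le> card (branch v u)"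
  using finite_branch[of v u] root_in_branch[of u v] by (auto simp: Suc_le_eq card_gt_0_iff)

text \<open>For \<open>t = 1\<close> the test vector is the indicator of the branch, whose quotient
  is 1 divided by the number of vertices.\<close>

lemma mu_le_1: "mu \<le> 1"
proof -
  let ?p = "real (card (branch v u1))"
  have "mu * ?p \<le> 1" using branch_test_vector[OF u1, of 1] by simp
  moreover have "mu * 1 \<le> mu * ?p"
    using branch_card_pos[OF u1] algebraic_connectivity(1) by (intro mult_left_mono) auto
  ultimately show ?thesis by simp
qed

text \<open>The branch is a leaf attached to the zero at \<open>v\<close>, so the equation there
  reads \<open>z u = mu * z u\<close>.\<close>

lemma perron_singleton:
  assumes u: "u \<in> perron_roots" "card (branch v u) = 1"
  shows "mu = 1"
proof -
  obtain z where z: "lap_eigenvector n E mu z" "z u \<noteq> 0" and vu: "E v u"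
    using u by (auto simp: perron_roots_def)
  have "branch v u = {u}" using u(2) root_in_branch[of u v] by (auto simp: card_1_singleton_iff)
  then have "{j. j < n \<and> E u j} = {v}"
    using branch_step[OF vu root_in_branch] vu adj_sym adj_less adj_neq by blast
  then have "lap_apply n E z u = z u"
    using eigenvector_vanishes[OF z(1)] by (simp add: lap_apply_def)
  then show ?thesis using z adj_less(2)[OF vu] by (simp add: lap_eigenvector_def)
qed

text \<open>With \<open>z v = 0\<close> the equations at the two vertices are those of the leg
  block, and \<open>mu \<le> 1\<close> selects its smaller eigenvalue.\<close>

lemma perron_pair:
  assumes u: "u \<in> perron_roots" "card (branch v u) = 2"
  shows "mu = golden"
proof -
  obtain z where z: "lap_eigenvector n E mu z" "z u \<noteq> 0" and vu: "E v u"
    using u by (auto simp: perron_roots_def)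
  obtain c where c: "branch v u = {u, c}" "c \<noteq> u" "E u c"
    using branch_pair[OF vu u(2)] by metis
  have cv: "c \<noteq> v" using branch_neq[OF vu] c by auto
  note zv = eigenvector_vanishes[OF z(1)]
  have "{j. j < n \<and> E u j} = {v, c}"
    using branch_step[OF vu root_in_branch] vu c adj_sym adj_less adj_neq by blast
  then have "lap_apply n E z u = z u + (z u - z c)"
    using cv zv by (simp add: lap_apply_def)
  then have 1: "z u + (z u - z c) = mu * z u"
    using z adj_less(2)[OF vu] by (simp add: lap_eigenvector_def)
  have "\<not> E c v" using branch_adj_root[OF vu, of c] c adj_sym by auto
  then have "{j. j < n \<and> E c j} = {u}"
    using branch_step[OF vu, of c] c adj_sym adj_less adj_neq by blast
  then have "lap_apply n E z c = z c - z u" by (simp add: lap_apply_def)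
  then have 2: "z c - z u = mu * z c"
    using z adj_less(2)[OF c(3)] by (simp add: lap_eigenvector_def)
  from 1 have zc: "z c = (2 - mu) * z u" by (simp add: algebra_simps)
  have "(mu\<^sup>2 - (3 * mu - 1)) * z u = 0"
    using 2 unfolding zc by (simp add: power2_eq_square algebra_simps)
  then show ?thesis using z(2) mu_le_1 golden_cong by simp
qed

lemma branches_le_1:
  assumes "mu = 1" "E v u"
  shows "card (branch v u) = 1"
  using branch_test_vector[OF assms(2), of 1] branch_card_pos[OF assms(2)] assms(1) by simp

lemma branches_le_2:
  assumes m: "mu = golden" and u: "E v u"
  shows "card (branch v u) \<le> 2"
proof -
  define p where "p = real (card (branch v u))"
  \<comment> \<open>The choice \<open>t = 2 - mu\<close> is the ratio of outer to inner entry on a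
    two-vertex branch, for which the inequality is an equality at \<open>p = 2\<close>. It reduces
    to \<open>(p - 2) * (1 - mu) \<le> 0\<close>.\<close>
  have "mu * (1 + (p - 1) * (2 - mu)\<^sup>2) \<le> 1 + (p - 1) * (2 - mu - 1)\<^sup>2"
    unfolding p_def using golden_bounds m by (intro branch_test_vector[OF u]) simp
  moreover have "mu * (2 - mu)\<^sup>2 = 1"
  proof -
    have sq: "(2 - mu)\<^sup>2 = 3 - mu" using golden_eq m by (simp add: power2_eq_square algebra_simps)
    show ?thesis unfolding sq using golden_eq m by (simp add: power2_eq_square algebra_simps)
  qed
  moreover have "(2 - mu - 1)\<^sup>2 = mu" using golden_eq m by (simp add: power2_eq_square algebra_simps)
  moreover have "mu * (1 + (p - 1) * (2 - mu)\<^sup>2) = mu + (p - 1) * (mu * (2 - mu)\<^sup>2)"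
    by (simp add: algebra_simps)
  ultimately have "mu + (p - 1) \<le> 1 + (p - 1) * mu" by simp
  then have "(p - 2) * (1 - mu) \<le> 0" by (simp add: algebra_simps)
  then have "p \<le> 2" using m golden_bounds by (simp add: mult_le_0_iff)
  then show ?thesis by (simp add: p_def)
qed

text \<open>All branches are single vertices, so the tree is a star with centre \<open>v\<close>.
  Its eigenvectors with 1 at a leaf \<open>a\<close> and -1 at the leaf \<open>u1\<close> are
  independent, one for each of the other \<open>n - 2\<close> leaves.\<close>

lemma star_mult:
  assumes m: "mu = 1"
  shows "n - 2 \<le> lap_mult n E mu"
proof -
  define N where "N = {u. E v u}"
  have finN: "finite N" using finite_neighbours by (simp add: N_def)
  have br: "branch v u = {u}" if "E v u" for u
    using branches_le_1[OF m that] root_in_branch[of u v] by (auto simp: card_1_singleton_iff)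
  have vn: "v < n" using adj_less u1 by blast
  have "E v x" if "x < n" "x \<noteq> v" for x using branch_cover[OF vn that] br by auto
  then have all: "{..<n} = insert v N" using adj_less vn by (auto simp: N_def)
  have vN: "v \<notin> N" using adj_neq by (auto simp: N_def)
  have "n = card (insert v N)" by (metis all card_lessThan)
  then have "n = Suc (card N)" using finN vN by simp
  then have "card (N - {u1}) = n - 2" using u1 finN by (simp add: N_def)
  moreover have "card (N - {u1}) \<le> lap_mult n E mu"
  proof (rule card_le_lap_mult)
    show "finite (N - {u1})" using finN by simp
    show "N - {u1} \<subseteq> {..<n}" using adj_less by (auto simp: N_def)
    let ?f = "\<lambda>a i. (if i = a then 1 else 0) + (if i = u1 then - 1 else 0 :: real)"
    show "lap_eigenvector n E mu (?f a)" if a: "a \<in> N - {u1}" for a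
      unfolding lap_eigenvector_def
    proof (intro allI impI)
      fix i assume "i < n"
      then consider "i = v" | "i \<in> N" "i \<noteq> v" using all by auto
      then show "lap_apply n E (?f a) i = mu * ?f a i"
      proof cases
        case 1
        have fv: "?f a v = 0" using a vN u1 by (auto simp: N_def)
        have "{j. j < n \<and> E v j} = N" using adj_less by (auto simp: N_def)
        then have "lap_apply n E (?f a) v = (\<Sum>j\<in>N. (if j = u1 then 1 else 0) - (if j = a then 1 else 0))"
          unfolding lap_apply_def fv by (intro sum.cong) auto
        also have "\<dots> = 0" using a u1 finN by (simp add: sum_subtractf N_def)
        finally show ?thesis using 1 fv by simp
      next
        case 2
        then have "{j. j < n \<and> E i j} = {v}"
          using br[of i] branch_step[of v i i] adj_sym adj_less adj_neq by (auto simp: N_def)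
        then show ?thesis using a vN u1 m by (auto simp: lap_apply_def N_def)
      qed
    qed
    show "?f a b = (if a = b then 1 else 0)" if "a \<in> N - {u1}" "b \<in> N - {u1}" for a b
      using that by auto
  qed
  ultimately show ?thesis by simp
qed

text \<open>With multiplicity \<open>m\<close> there are at least \<open>m + 1\<close> Perron roots;
  if all their branches had three vertices or more, \<open>n\<close> would be at least
  \<open>3 * (m + 1) + 1\<close>, against \<open>large\<close>. The assumption \<open>small\<close>
  excludes the star.\<close>

lemma high_multiplicity_imp_spider:
  assumes large: "n < 3 * lap_mult n E mu + 4" and small: "lap_mult n E mu < n - 2"
  shows "\<exists>s k. 2 \<le> k \<and> k \<le> s \<and> n = s + k + 1 \<and> graph_iso n E (spider s k)"
proof -
  have "\<exists>u\<in>perron_roots. card (branch v u) \<le> 2"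
  proof (rule ccontr)
    assume "\<not> ?thesis"
    then have "(\<Sum>u\<in>perron_roots. 3) \<le> (\<Sum>u\<in>perron_roots. card (branch v u))"
      by (intro sum_mono) force
    moreover have "1 + (\<Sum>u\<in>perron_roots. card (branch v u)) \<le> n"
      by (rule card_branches) (auto simp: perron_roots_def)
    ultimately show False using mult_less_perron_roots large by simp
  qed
  then obtain u where u: "u \<in> perron_roots" "card (branch v u) \<le> 2" by blast
  have "card (branch v u) \<noteq> 1"
    using perron_singleton[OF u(1)] star_mult small by fastforce
  moreover have "1 \<le> card (branch v u)" using u by (intro branch_card_pos) (simp add: perron_roots_def)
  ultimately have "card (branch v u) = 2" using u(2) by linarith
  then have m: "mu = golden" by (rule perron_pair[OF u(1)])
  note le2 = branches_le_2[OF m]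
  have two: "card (branch v u) = 2" if "u \<in> perron_roots" for u
  proof -
    have "card (branch v u) \<noteq> 1" using perron_singleton[OF that] m golden_bounds by auto
    moreover have "E v u" using that by (simp add: perron_roots_def)
    ultimately show ?thesis using le2[of u] branch_card_pos[of u] by linarith
  qed
  let ?L = "{u. E v u \<and> card (branch v u) = 2}"
  have "finite ?L" by (rule finite_subset[OF _ finite_neighbours]) auto
  \<comment> \<open>Both \<open>u1\<close> and \<open>u2\<close> are Perron roots and so have
    two-vertex branches; hence at least two legs are long.\<close>
  then have "card {u1, u2} \<le> card ?L"
    using two u1_perron u2_perron u1 u2 by (intro card_mono) auto
  then have "2 \<le> card ?L" using u12 by simp
  then show ?thesis
    using small_branches_imp_spider[OF adj_less(1)[OF u1] le2] by blast
qed

end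

lemma (in tree) characteristic_vertex_locale:
  assumes "2 \<le> lap_mult n E mu"
  shows "\<exists>v u1 u2 w. characteristic_vertex n E v u1 u2 w"
proof (rule characteristic_vertex_exists[OF assms])
  fix v u1 u2 w
  assume a: "E v u1" "E v u2" "u1 \<noteq> u2" "lap_eigenvector n E mu w"
    "\<And>i. i \<in> branch v u1 \<Longrightarrow> 0 < w i" "\<And>i. i \<in> branch v u2 \<Longrightarrow> w i < 0"
    "\<And>i. i \<notin> branch v u1 \<Longrightarrow> i \<notin> branch v u2 \<Longrightarrow> w i = 0"
  have "characteristic_vertex n E v u1 u2 w"
    by (rule characteristic_vertex.intro[OF tree_axioms characteristic_vertex_axioms.intro]) (fact a)+
  then show ?thesis by blast
qed

theorem theorem4p4:
  fixes j n :: nat and E :: "nat \<Rightarrow> nat \<Rightarrow> bool"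
  assumes "j \<ge> 2" and "is_tree n E" and "n > 10 * j"
  shows "lap_mult n E (lap_mu n E 2) = n div 2 - j \<longleftrightarrow>
         graph_iso n E (spider ((n + 1) div 2 + j - 2) (n div 2 - j + 1))"
proof -
  interpret tree n E
    using assms by unfold_locales (auto simp: is_tree_def)
  show ?thesis
  proof
    assume "graph_iso n E (spider ((n + 1) div 2 + j - 2) (n div 2 - j + 1))"
    \<comment> \<open>The parameters satisfy \<open>s + k + 1 = n\<close>, and
      \<open>k \<le> s\<close> because \<open>2 * j \<ge> 3\<close>.\<close>
    then have "lap_mult n E mu = (n div 2 - j + 1) - 1"
      by (rule spider_lap_mult) (use assms in linarith)+
    then show "lap_mult n E mu = n div 2 - j" by simp
  next
    assume m: "lap_mult n E mu = n div 2 - j"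
    \<comment> \<open>From \<open>n > 10 * j\<close> follows that \<open>n div 2 - j\<close> is at
      least \<open>4 * j\<close>, so the subtraction is not truncated.\<close>
    then have "2 \<le> lap_mult n E mu" using assms by linarith
    then obtain v u1 u2 w where "characteristic_vertex n E v u1 u2 w"
      using characteristic_vertex_locale by blast
    then interpret characteristic_vertex n E v u1 u2 w .
    \<comment> \<open>Since \<open>n div 2\<close> is at least \<open>(n - 1) / 2\<close>, the first
      bound holds as soon as \<open>n > 6 * j - 5\<close>.\<close>
    have "n < 3 * lap_mult n E mu + 4" "lap_mult n E mu < n - 2"
      unfolding m using assms by linarith+
    then obtain s k where sk: "2 \<le> k" "k \<le> s" "n = s + k + 1" "graph_iso n E (spider s k)"
      using high_multiplicity_imp_spider by blast
    have "lap_mult n E mu = k - 1" by (rule spider_lap_mult[OF sk(4,3,1,2)])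
    \<comment> \<open>The multiplicity fixes \<open>k\<close>, then \<open>n = s + k + 1\<close>
      fixes \<open>s\<close>; here \<open>n - n div 2\<close> is
      \<open>(n + 1) div 2\<close>.\<close>
    then have "(n + 1) div 2 + j - 2 = s" "n div 2 - j + 1 = k"
      using m sk(1-3) assms by linarith+
    then show "graph_iso n E (spider ((n + 1) div 2 + j - 2) (n div 2 - j + 1))"
      using sk(4) by (simp only:)
  qed
qed

end
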